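(* Let $M\in\mathcal{Z}_+(k,t)$ have $\ell$ nonzero entries, let $b\in\mathbb{Q}^k$ with $b>0$, and let $P_M=\{x\in\mathbb{R}^t: Mx\le b,\ x\ge 0\}$. Then in time $O(\ell t^3)$ one can construct a matrix $\bar M\in\mathcal{M}_2(\ell',t)$ and a vector $\bar b\in\mathbb{Q}^{\ell'}$ with $\ell'\le\ell$ such that $$P_M\subseteq\{x\in\mathbb{R}^t: \bar Mx\le\bar b,\ x\ge 0\}\subseteq B^2P_M,$$ where $B=\sum_{j=1}^k b_j/\min_{i\in[k]}b_i$. Moreover, the encoding sizes of the entries of $\bar M$ and $\bar b$ are polynomially bounded in the encoding size of the input.
   Context: $\mathcal{Z}_+(k,t)$ is the set of matrices $M\in\mathbb{Q}^{k\times t}$ such that all off-diagonal entries are nonpositive (the diagonal entries are $M_{ii}$ for $1\le i\le\min\{k,t\}$) and all column sums are nonnegative. $\mathcal{M}_2(m,n)$ is the set of $m\times n$ rational matrices having at most one positive and at most one negative entry in each row. For a set $P$ and $\alpha>0$, $\alpha P=\{\alpha x: x\in P\}$. *)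

theory Defs
  imports
    "Jordan_Normal_Form.Matrix"
    "HOL-Computational_Algebra.Polynomial"
    Complex_Main
begin

section \<open>Matrices and polyhedra\<close>

text \<open>Row and column indices start at 0, so the diagonal entries are those at \<open>(i, i)\<close>
  with \<open>i < min k t\<close>.\<close>

definition Z_plus :: "nat \<Rightarrow> nat \<Rightarrow> rat mat set" where
  "Z_plus k t = {M \<in> carrier_mat k t.
     (\<forall>i<k. \<forall>j<t. i \<noteq> j \<longrightarrow> M $$ (i, j) \<le> 0) \<and>
     (\<forall>j<t. 0 \<le> (\<Sum>i<k. M $$ (i, j)))}"

definition M_two :: "nat \<Rightarrow> nat \<Rightarrow> rat mat set" where
  "M_two m n = {A \<in> carrier_mat m n.
     \<forall>i<m. card {j. j < n \<and> 0 < A $$ (i, j)} \<le> 1 \<and>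
           card {j. j < n \<and> A $$ (i, j) < 0} \<le> 1}"

definition nnz :: "rat mat \<Rightarrow> nat" where
  "nnz A = card {(i, j). i < dim_row A \<and> j < dim_col A \<and> A $$ (i, j) \<noteq> 0}"

definition polyhedron_nonneg :: "rat mat \<Rightarrow> rat vec \<Rightarrow> real vec set" where
  "polyhedron_nonneg A b = {x \<in> carrier_vec (dim_col A).
     map_mat real_of_rat A *\<^sub>v x \<le> map_vec real_of_rat b \<and> 0\<^sub>v (dim_col A) \<le> x}"

definition scale_set :: "real \<Rightarrow> real vec set \<Rightarrow> real vec set" where
  "scale_set \<alpha> P = {\<alpha> \<cdot>\<^sub>v x |x. x \<in> P}"

definition B_ratio :: "rat vec \<Rightarrow> rat" where
  "B_ratio b = (\<Sum>j<dim_vec b. b $ j) / Min {b $ i |i. i < dim_vec b}"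

section \<open>Encoding sizes\<close>

text \<open>The usual binary encoding size, as in Schrijver's
  \<^emph>\<open>Theory of Linear and Integer Programming\<close>: a rational \<open>p / q\<close> in lowest terms with
  \<open>q > 0\<close> has size \<open>1 + \<lceil>log 2 (\<bar>p\<bar> + 1)\<rceil> + \<lceil>log 2 (q + 1)\<rceil>\<close>; vectors and matrices contribute
  their number of entries plus the sizes of all entries.\<close>

definition enc_rat :: "rat \<Rightarrow> nat" where
  "enc_rat r = (case quotient_of r of (p, q) \<Rightarrow>
     1 + nat \<lceil>log 2 (of_int (\<bar>p\<bar> + 1))\<rceil> + nat \<lceil>log 2 (of_int (q + 1))\<rceil>)"

definition enc_vec :: "rat vec \<Rightarrow> nat" where
  "enc_vec b = dim_vec b + (\<Sum>i<dim_vec b. enc_rat (b $ i))"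

definition enc_mat :: "rat mat \<Rightarrow> nat" where
  "enc_mat A = dim_row A * dim_col A + (\<Sum>i<dim_row A. \<Sum>j<dim_col A. enc_rat (A $$ (i, j)))"

section \<open>The model of computation\<close>

text \<open>Running times are counted in the arithmetic model: an algorithm is one fixed program (the
  same for all dimensions and all data) of a random access machine that stores natural numbers,
  used for indexing and counting, and rational numbers. Programs are structured; their variables
  are arrays of fixed arity, addressed by a name and a list of indices, with scalars as the arrays
  of arity 0. Every array access, constant, arithmetic operation, comparison, Boolean connective,
  assignment and branching decision costs one time unit. There is no rounding and no way to turn
  a rational number into an index.\<close>

record store =
  nats :: "string \<Rightarrow> nat list \<Rightarrow> nat"
  rats :: "string \<Rightarrow> nat list \<Rightarrow> rat"

datatype nexp =
    NConst nat
  | NVar string "nexp list"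
  | NPlus nexp nexp
  | NMinus nexp nexp

datatype qexp =
    QConst rat
  | QVar string "nexp list"
  | QPlus qexp qexp
  | QMinus qexp qexp
  | QTimes qexp qexp
  | QDivide qexp qexp

datatype bexp =
    NLess nexp nexp
  | NEq nexp nexp
  | QLess qexp qexp
  | QEq qexp qexp
  | BNot bexp
  | BAnd bexp bexp

text \<open>As usual in HOL, subtraction of indices is truncated at 0 and division by 0 yields 0.\<close>

primrec nval :: "store \<Rightarrow> nexp \<Rightarrow> nat" where
  "nval s (NConst n) = n"
| "nval s (NVar x es) = nats s x (map (nval s) es)"
| "nval s (NPlus a b) = nval s a + nval s b"
| "nval s (NMinus a b) = nval s a - nval s b"

primrec qval :: "store \<Rightarrow> qexp \<Rightarrow> rat" where
  "qval s (QConst q) = q"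
| "qval s (QVar x es) = rats s x (map (nval s) es)"
| "qval s (QPlus a b) = qval s a + qval s b"
| "qval s (QMinus a b) = qval s a - qval s b"
| "qval s (QTimes a b) = qval s a * qval s b"
| "qval s (QDivide a b) = qval s a / qval s b"

primrec bval :: "store \<Rightarrow> bexp \<Rightarrow> bool" where
  "bval s (NLess a b) = (nval s a < nval s b)"
| "bval s (NEq a b) = (nval s a = nval s b)"
| "bval s (QLess a b) = (qval s a < qval s b)"
| "bval s (QEq a b) = (qval s a = qval s b)"
| "bval s (BNot c) = (\<not> bval s c)"
| "bval s (BAnd c d) = (bval s c \<and> bval s d)"

primrec ncost :: "nexp \<Rightarrow> nat" where
  "ncost (NConst n) = 1"
| "ncost (NVar x es) = 1 + sum_list (map ncost es)"
| "ncost (NPlus a b) = 1 + ncost a + ncost b"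
| "ncost (NMinus a b) = 1 + ncost a + ncost b"

primrec qcost :: "qexp \<Rightarrow> nat" where
  "qcost (QConst q) = 1"
| "qcost (QVar x es) = 1 + sum_list (map ncost es)"
| "qcost (QPlus a b) = 1 + qcost a + qcost b"
| "qcost (QMinus a b) = 1 + qcost a + qcost b"
| "qcost (QTimes a b) = 1 + qcost a + qcost b"
| "qcost (QDivide a b) = 1 + qcost a + qcost b"

primrec bcost :: "bexp \<Rightarrow> nat" where
  "bcost (NLess a b) = 1 + ncost a + ncost b"
| "bcost (NEq a b) = 1 + ncost a + ncost b"
| "bcost (QLess a b) = 1 + qcost a + qcost b"
| "bcost (QEq a b) = 1 + qcost a + qcost b"
| "bcost (BNot c) = 1 + bcost c"
| "bcost (BAnd c d) = 1 + bcost c + bcost d"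

datatype com =
    Skip
  | NAssign string "nexp list" nexp
  | QAssign string "nexp list" qexp
  | Seq com com
  | Cond bexp com com
  | While bexp com

definition upd :: "(string \<Rightarrow> nat list \<Rightarrow> 'a) \<Rightarrow> string \<Rightarrow> nat list \<Rightarrow> 'a \<Rightarrow> string \<Rightarrow> nat list \<Rightarrow> 'a" where
  "upd f x is v = f(x := (f x)(is := v))"

text \<open>\<open>exec c s n s'\<close>: started in the store \<open>s\<close>, the program \<open>c\<close> terminates in the store \<open>s'\<close>
  after exactly \<open>n\<close> time units.\<close>

inductive exec :: "com \<Rightarrow> store \<Rightarrow> nat \<Rightarrow> store \<Rightarrow> bool" where
  Skip: "exec Skip s 1 s"
| NAssign: "exec (NAssign x es e) s (1 + sum_list (map ncost es) + ncost e)
     (s\<lparr>nats := upd (nats s) x (map (nval s) es) (nval s e)\<rparr>)"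
| QAssign: "exec (QAssign x es e) s (1 + sum_list (map ncost es) + qcost e)
     (s\<lparr>rats := upd (rats s) x (map (nval s) es) (qval s e)\<rparr>)"
| Seq: "exec c s m s' \<Longrightarrow> exec d s' n s'' \<Longrightarrow> exec (Seq c d) s (m + n) s''"
| CondTrue: "bval s g \<Longrightarrow> exec c s n s' \<Longrightarrow> exec (Cond g c d) s (1 + bcost g + n) s'"
| CondFalse: "\<not> bval s g \<Longrightarrow> exec d s n s' \<Longrightarrow> exec (Cond g c d) s (1 + bcost g + n) s'"
| WhileFalse: "\<not> bval s g \<Longrightarrow> exec (While g c) s (1 + bcost g) s"
| WhileTrue: "bval s g \<Longrightarrow> exec c s m s' \<Longrightarrow> exec (While g c) s' n s'' \<Longrightarrow>
     exec (While g c) s (1 + bcost g + m + n) s''"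

lemma exec_deterministic:
  "exec c s m s' \<Longrightarrow> exec c s n s'' \<Longrightarrow> m = n \<and> s' = s''"
proof (induction arbitrary: n s'' rule: exec.induct)
  case (Skip s)
  then show ?case by (cases rule: exec.cases) simp_all
next
  case (NAssign x es e s)
  then show ?case by (cases rule: exec.cases) simp_all
next
  case (QAssign x es e s)
  then show ?case by (cases rule: exec.cases) simp_all
next
  case (Seq c s m s' d k t)
  from Seq.prems Seq.IH show ?case by (cases rule: exec.cases) fastforce
next
  case (CondTrue s g c m s' d)
  from CondTrue.prems CondTrue.hyps CondTrue.IH show ?case by (cases rule: exec.cases) fastforce+
next
  case (CondFalse s g d m s' c)
  from CondFalse.prems CondFalse.hyps CondFalse.IH show ?case by (cases rule: exec.cases) fastforce+
next
  case (WhileFalse s g c)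
  from WhileFalse.prems WhileFalse.hyps show ?case by (cases rule: exec.cases) simp_all
next
  case (WhileTrue s g c m s' k t)
  from WhileTrue.prems WhileTrue.hyps WhileTrue.IH show ?case by (cases rule: exec.cases) fastforce+
qed

text \<open>The input consists of the dimensions and the (dense) data; all other cells are 0 initially.
  The output is read off from \<open>rows\<close> (the number of rows), \<open>Mbar\<close> and \<open>bbar\<close>.\<close>

definition input_store :: "rat mat \<Rightarrow> rat vec \<Rightarrow> store" where
  "input_store M b = \<lparr>
     nats = (\<lambda>x is.
       if x = ''k'' \<and> is = [] then dim_row M
       else if x = ''t'' \<and> is = [] then dim_col M
       else 0),
     rats = (\<lambda>x is.
       if x = ''M'' \<and> (\<exists>i<dim_row M. \<exists>j<dim_col M. is = [i, j]) then M $$ (is ! 0, is ! 1)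
       else if x = ''b'' \<and> (\<exists>i<dim_vec b. is = [i]) then b $ (is ! 0)
       else 0)\<rparr>"

definition output_rows :: "store \<Rightarrow> nat" where
  "output_rows s = nats s ''rows'' []"

definition output_mat :: "nat \<Rightarrow> store \<Rightarrow> rat mat" where
  "output_mat t s = mat (output_rows s) t (\<lambda>(i, j). rats s ''Mbar'' [i, j])"

definition output_vec :: "store \<Rightarrow> rat vec" where
  "output_vec s = vec (output_rows s) (\<lambda>i. rats s ''bbar'' [i])"

end

theory Submission
  imports Defs "Jordan_Normal_Form.Determinant"
begin

text \<open>For every nonzero entry \<open>(i, j)\<close> of \<open>M\<close>, eliminate all variables except \<open>x\<^sub>i\<close> and \<open>x\<^sub>j\<close> from
  \<open>M x \<le> b\<close> by Gaussian elimination and keep row \<open>i\<close> of the result (for \<open>i = j\<close> this is an upper bound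
  on \<open>x\<^sub>i\<close>). Because off-diagonal entries are nonpositive, each step adds nonnegative multiples of
  rows, so the constraint \<open>a x\<^sub>i - e x\<^sub>j \<le> c\<close> obtained is valid on \<open>P\<^sub>M\<close>; because column sums are
  nonnegative, \<open>c\<close> is at most \<open>S = \<Sum> b\<close>.

  Conversely, back substitution in the elimination for \<open>(i, i)\<close> yields \<open>z \<ge> 0\<close> with \<open>z\<^sub>i = 1\<close> such that
  \<open>(M z)\<^sub>i\<close> is the leading coefficient of constraint \<open>(i, i)\<close> and \<open>(M z)\<^sub>u \<ge> 0\<close> for all rows \<open>u\<close> that
  influence row \<open>i\<close>. Hence \<open>e z\<^sub>j \<le> a\<close> and \<open>\<bar>M\<^sub>i\<^sub>j\<bar> \<le> e\<close> for every constraint \<open>(i, j)\<close>. Adding constraint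
  \<open>(i, i)\<close> to the constraints \<open>(i, j)\<close> with multipliers \<open>\<bar>M\<^sub>i\<^sub>j\<bar> z\<^sub>j / a \<le> 1\<close> gives \<open>(M x)\<^sub>i \<le> k S\<close>, and
  \<open>k S \<le> S\<^sup>2 / min b \<le> B\<^sup>2 b\<^sub>i\<close>.\<close>

section \<open>Elimination in Z-matrices with nonnegative column sums\<close>

text \<open>A zero pivot leaves the matrix unchanged, since \<open>x / 0 = 0\<close>. For the matrices
  considered here this is harmless: a vanishing diagonal entry forces a vanishing column.\<close>

definition pivot :: "'i \<Rightarrow> ('i \<Rightarrow> 'i \<Rightarrow> 'a::field) \<Rightarrow> 'i \<Rightarrow> 'i \<Rightarrow> 'a" where
  "pivot v W u w = (if u = v then W u w else W u w - W u v / W v v * W v w)"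

definition Z_plus_on :: "'i set \<Rightarrow> ('i \<Rightarrow> 'i \<Rightarrow> 'a::linordered_field) \<Rightarrow> bool" where
  "Z_plus_on R W \<longleftrightarrow> finite R \<and> (\<forall>u\<in>R. \<forall>w\<in>R. u \<noteq> w \<longrightarrow> W u w \<le> 0) \<and> (\<forall>w\<in>R. 0 \<le> (\<Sum>u\<in>R. W u w))"

section \<open>One elimination step: signs, column sums and valid inequalities\<close>

lemma Z_plus_on_diag:
  assumes "Z_plus_on R W" "w \<in> R"
  shows "0 \<le> W w w"
proof -
  have "(\<Sum>u\<in>R. W u w) = W w w + (\<Sum>u\<in>R-{w}. W u w)"
    using assms by (simp add: Z_plus_on_def sum.remove)
  moreover have "(\<Sum>u\<in>R-{w}. W u w) \<le> 0"
    using assms by (intro sum_nonpos) (auto simp: Z_plus_on_def)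
  moreover have "0 \<le> (\<Sum>u\<in>R. W u w)" using assms by (simp add: Z_plus_on_def)
  ultimately show ?thesis by linarith
qed

text \<open>With a zero diagonal entry, the column consists of nonpositive terms whose sum is
  nonnegative, so every term vanishes. A zero pivot therefore leaves nothing to eliminate.\<close>

lemma Z_plus_on_zero_column:
  assumes Z: "Z_plus_on R W" and w: "w \<in> R" "W w w = 0" and u: "u \<in> R"
  shows "W u w = 0"
proof (cases "u = w")
  case False
  have "(\<Sum>u\<in>R. W u w) = W w w + (\<Sum>u\<in>R-{w}. W u w)"
    using assms by (simp add: Z_plus_on_def sum.remove)
  then have "0 \<le> (\<Sum>u\<in>R-{w}. W u w)"
    using Z w by (auto simp: Z_plus_on_def)
  then have "(\<Sum>u\<in>R-{w}. - W u w) \<le> 0" by (simp add: sum_negf)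
  moreover have "0 \<le> - W u w" if "u \<in> R-{w}" for u
    using that w Z by (auto simp: Z_plus_on_def)
  ultimately have "(\<Sum>u\<in>R-{w}. - W u w) = 0" by (meson order.antisym sum_nonneg)
  then have "\<forall>u\<in>R-{w}. - W u w = 0"
    using \<open>\<And>u. u \<in> R-{w} \<Longrightarrow> 0 \<le> - W u w\<close> Z by (subst (asm) sum_nonneg_eq_0_iff) (auto simp: Z_plus_on_def)
  then show ?thesis using u False by simp
qed (use w in simp)

text \<open>Applied to row \<open>v\<close> itself, the elimination formula would give 0, so the
  update can be summed over all of \<open>R\<close>. The column \<open>w\<close> is arbitrary, so
  the identity also serves for the right-hand side.\<close>

lemma sum_pivot_column:
  assumes "finite R" "v \<in> R" "W v v \<noteq> 0"
  shows "(\<Sum>u\<in>R-{v}. pivot v W u w)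
    = (\<Sum>u\<in>R. W u w) - (\<Sum>u\<in>R. W u v) / W v v * W v w"
proof -
  have "(\<Sum>u\<in>R-{v}. pivot v W u w) = (\<Sum>u\<in>R-{v}. W u w - W u v / W v v * W v w)"
    by (intro sum.cong) (auto simp: pivot_def)
  also have "\<dots> = (\<Sum>u\<in>R-{v}. W u w) - (\<Sum>u\<in>R-{v}. W u v) / W v v * W v w"
    by (simp add: sum_subtractf sum_divide_distrib sum_distrib_right)
  also have "\<dots> = ((\<Sum>u\<in>R. W u w) - W v w) - ((\<Sum>u\<in>R. W u v) - W v v) / W v v * W v w"
    using assms by (simp add: sum.remove)
  also have "\<dots> = (\<Sum>u\<in>R. W u w) - (\<Sum>u\<in>R. W u v) / W v v * W v w"
    using assms(3) by (simp add: field_simps)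
  finally show ?thesis .
qed

lemma pivot_zero: "W v v = 0 \<Longrightarrow> pivot v W = W"
  by (auto simp: pivot_def fun_eq_iff)

text \<open>What is subtracted is a product of two nonpositive entries divided by a nonnegative
  pivot. The case \<open>u = w\<close> is included, so diagonal entries do not grow either.\<close>

lemma pivot_offdiag_le:
  assumes Z: "Z_plus_on R W" and "v \<in> R" "u \<in> R" "w \<in> R" "u \<noteq> v" "w \<noteq> v"
  shows "pivot v W u w \<le> W u w"
proof -
  have "W u v \<le> 0" "W v w \<le> 0" "0 \<le> W v v"
    using assms Z_plus_on_diag[OF Z] by (auto simp: Z_plus_on_def)
  then have "0 \<le> W u v / W v v * W v w"
    by (intro mult_nonpos_nonpos divide_nonpos_nonneg)
  then show ?thesis using assms by (simp add: pivot_def)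
qed

text \<open>The Schur complement stays in the class: a new column sum is the old one minus a
  nonnegative multiple of the nonpositive entry \<open>W v w\<close>. With a zero pivot, the only
  change is that this entry drops out of the sum.\<close>

lemma Z_plus_on_pivot:
  assumes Z: "Z_plus_on R W" and v: "v \<in> R"
  shows "Z_plus_on (R - {v}) (pivot v W)"
proof -
  have off: "pivot v W u w \<le> 0" if "u \<in> R-{v}" "w \<in> R-{v}" "u \<noteq> w" for u w
    using pivot_offdiag_le[OF Z v, of u w] that Z by (auto simp: Z_plus_on_def intro: order_trans)
  have "0 \<le> (\<Sum>u\<in>R-{v}. pivot v W u w)" if w: "w \<in> R-{v}" for w
  proof (cases "W v v = 0")
    case True
    have "(\<Sum>u\<in>R. W u w) = W v w + (\<Sum>u\<in>R-{v}. W u w)"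
      using Z v by (simp add: Z_plus_on_def sum.remove)
    moreover have "W v w \<le> 0" using Z v w by (auto simp: Z_plus_on_def)
    moreover have "0 \<le> (\<Sum>u\<in>R. W u w)" using Z w by (auto simp: Z_plus_on_def)
    ultimately show ?thesis using True by (simp add: pivot_zero)
  next
    case False
    have "W v w \<le> 0" "0 \<le> (\<Sum>u\<in>R. W u v)" "0 \<le> (\<Sum>u\<in>R. W u w)"
      using Z v w by (auto simp: Z_plus_on_def)
    moreover have "0 \<le> W v v" using Z_plus_on_diag[OF Z v] .
    ultimately have "(\<Sum>u\<in>R. W u v) / W v v * W v w \<le> 0"
      by (intro mult_nonneg_nonpos divide_nonneg_nonneg)
    then show ?thesis
      using Z v False \<open>0 \<le> (\<Sum>u\<in>R. W u w)\<close> by (simp add: sum_pivot_column Z_plus_on_def)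
  qed
  then show ?thesis using off Z by (auto simp: Z_plus_on_def)
qed

text \<open>Every other row receives a nonnegative multiple of the right-hand side of row
  \<open>v\<close>. Because column \<open>v\<close> has a nonnegative sum, the amounts handed out
  total at most \<open>W v h\<close>. Right-hand sides thus stay below the sum of the original ones,
  however many variables are eliminated.\<close>

lemma pivot_rhs:
  assumes Z: "Z_plus_on R W" and v: "v \<in> R" and h: "\<forall>u\<in>R. 0 \<le> W u h"
  shows "\<forall>u\<in>R-{v}. 0 \<le> pivot v W u h" "(\<Sum>u\<in>R-{v}. pivot v W u h) \<le> (\<Sum>u\<in>R. W u h)"
proof -
  have d: "0 \<le> W v v" using Z_plus_on_diag[OF Z v] .
  show "\<forall>u\<in>R-{v}. 0 \<le> pivot v W u h"
  proof
    fix u assume u: "u \<in> R-{v}"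
    have "W u v \<le> 0" using Z u v by (auto simp: Z_plus_on_def)
    then have "W u v / W v v * W v h \<le> 0"
      using d h v by (intro mult_nonpos_nonneg divide_nonpos_nonneg) auto
    then show "0 \<le> pivot v W u h" using u h by (auto simp: pivot_def intro: order_trans)
  qed
  show "(\<Sum>u\<in>R-{v}. pivot v W u h) \<le> (\<Sum>u\<in>R. W u h)"
  proof (cases "W v v = 0")
    case True
    then show ?thesis using Z h v by (auto simp: pivot_zero Z_plus_on_def intro!: sum_mono2)
  next
    case False
    have "0 \<le> (\<Sum>u\<in>R. W u v) / W v v * W v h"
      using Z v h d by (intro mult_nonneg_nonneg divide_nonneg_nonneg) (auto simp: Z_plus_on_def)
    then show ?thesis using Z v False by (simp add: sum_pivot_column Z_plus_on_def)
  qed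
qed

lemma pivot_row_sum:
  assumes Z: "Z_plus_on R W" and v: "v \<in> R" and u: "u \<in> R" "u \<noteq> v"
  shows "(\<Sum>w\<in>R-{v}. pivot v W u w * x w)
    = (\<Sum>w\<in>R. W u w * x w) - W u v / W v v * (\<Sum>w\<in>R. W v w * x w)"
proof -
  have "(\<Sum>w\<in>R-{v}. pivot v W u w * x w)
      = (\<Sum>w\<in>R-{v}. W u w * x w - W u v / W v v * (W v w * x w))"
    using u by (intro sum.cong) (auto simp: pivot_def algebra_simps)
  also have "\<dots> = (\<Sum>w\<in>R-{v}. W u w * x w) - W u v / W v v * (\<Sum>w\<in>R-{v}. W v w * x w)"
    by (simp add: sum_subtractf sum_distrib_left)
  also have "\<dots> = ((\<Sum>w\<in>R. W u w * x w) - W u v * x v)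
      - W u v / W v v * ((\<Sum>w\<in>R. W v w * x w) - W v v * x v)"
    using Z v by (simp add: sum.remove Z_plus_on_def)
  \<comment> \<open>The coefficient of \<open>x v\<close> cancels if the pivot is nonzero; with a
    zero pivot, \<open>W u v\<close> is itself 0.\<close>
  also have "\<dots> = (\<Sum>w\<in>R. W u w * x w) - W u v / W v v * (\<Sum>w\<in>R. W v w * x w)"
    using Z_plus_on_zero_column[OF Z v _ u(1)] by (cases "W v v = 0") (auto simp: field_simps)
  finally show ?thesis .
qed

lemma pivot_valid:
  assumes Z: "Z_plus_on R W" and v: "v \<in> R"
    and x: "\<forall>u\<in>R. (\<Sum>w\<in>R. W u w * x w) \<le> W u h"
  shows "\<forall>u\<in>R-{v}. (\<Sum>w\<in>R-{v}. pivot v W u w * x w) \<le> pivot v W u h"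
proof
  fix u assume u: "u \<in> R-{v}"
  have "W u v \<le> 0" "0 \<le> W v v" using Z u v Z_plus_on_diag[OF Z v] by (auto simp: Z_plus_on_def)
  then have "W u v / W v v \<le> 0" by (intro divide_nonpos_nonneg)
  then have "W u v / W v v * W v h \<le> W u v / W v v * (\<Sum>w\<in>R. W v w * x w)"
    using x v by (intro mult_left_mono_neg) auto
  moreover have "(\<Sum>w\<in>R. W u w * x w) \<le> W u h" using x u by auto
  ultimately show "(\<Sum>w\<in>R-{v}. pivot v W u w * x w) \<le> pivot v W u h"
    using u by (simp add: pivot_row_sum[OF Z v]) (simp add: pivot_def)
qed

text \<open>Inequalities are required on \<open>A\<close> only: a group of variables that is unbounded and fed by others
  but does not influence them admits no supersolution.\<close>

definition supersolution :: "'i set \<Rightarrow> ('i \<Rightarrow> 'i \<Rightarrow> 'a::linordered_field) \<Rightarrow> 'i set \<Rightarrow> ('i \<Rightarrow> 'a) \<Rightarrow> bool" where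
  "supersolution R W A z \<longleftrightarrow> (\<forall>u\<in>A\<inter>R. \<forall>w\<in>R-A. W u w = 0)
    \<and> (\<forall>w. w \<notin> A \<longrightarrow> z w = 0) \<and> (\<forall>u\<in>A\<inter>R. 0 \<le> (\<Sum>w\<in>R. W u w * z w))"

section \<open>Invariants of repeated elimination, and back substitution\<close>

lemma supersolution_pivot:
  assumes Z: "Z_plus_on R W" and v: "v \<in> R" and s: "supersolution R W A z"
  shows "supersolution (R-{v}) (pivot v W) A z"
  unfolding supersolution_def
proof (intro conjI ballI)
  show "\<forall>w. w \<notin> A \<longrightarrow> z w = 0" using s by (simp add: supersolution_def)
next
  fix u w assume u: "u \<in> A \<inter> (R - {v})" and w: "w \<in> R-{v}-A"
  show "pivot v W u w = 0"
    using u w v s by (cases "v \<in> A") (auto simp: supersolution_def pivot_def)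
next
  fix u assume u: "u \<in> A \<inter> (R - {v})"
  have "W u v \<le> 0" "0 \<le> W v v" using Z u v Z_plus_on_diag[OF Z v] by (auto simp: Z_plus_on_def)
  then have n: "W u v / W v v \<le> 0" by (intro divide_nonpos_nonneg)
  have "W u v / W v v * (\<Sum>w\<in>R. W v w * z w) \<le> 0"
  \<comment> \<open>Inside \<open>A\<close>, row \<open>v\<close> has a nonnegative value and enters
    with a nonnegative multiplier. Outside \<open>A\<close>, closedness of \<open>A\<close> gives
    \<open>W u v = 0\<close>, so row \<open>v\<close>, about which nothing is known, contributes
    nothing.\<close>
  proof (cases "v \<in> A")
    case True
    then show ?thesis using n s v by (intro mult_nonpos_nonneg) (auto simp: supersolution_def)
  next
    case False
    then show ?thesis using s u v by (auto simp: supersolution_def)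
  qed
  moreover have "0 \<le> (\<Sum>w\<in>R. W u w * z w)" using u s by (auto simp: supersolution_def)
  ultimately show "0 \<le> (\<Sum>w\<in>R-{v}. pivot v W u w * z w)"
    using u pivot_row_sum[OF Z v, of u z] by auto
qed

text \<open>The claims go through one common induction because each single-step lemma needs
  \<open>Z_plus_on\<close> for the current matrix. The index \<open>h\<close> stands for the column
  of right-hand sides.\<close>

lemma fold_pivot_invariants:
  assumes "Z_plus_on R W" "distinct vs" "set vs \<subseteq> R"
  shows "Z_plus_on (R - set vs) (fold pivot vs W)"
    and "u \<in> R - set vs \<Longrightarrow> w \<in> R - set vs \<Longrightarrow> fold pivot vs W u w \<le> W u w"
    and "\<forall>u\<in>R. 0 \<le> W u h \<Longrightarrow> \<forall>u\<in>R - set vs. 0 \<le> fold pivot vs W u h"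
    and "\<forall>u\<in>R. 0 \<le> W u h \<Longrightarrow> (\<Sum>u\<in>R - set vs. fold pivot vs W u h) \<le> (\<Sum>u\<in>R. W u h)"
    and "\<forall>u\<in>R. (\<Sum>w\<in>R. W u w * x w) \<le> W u h \<Longrightarrow>
      \<forall>u\<in>R - set vs. (\<Sum>w\<in>R - set vs. fold pivot vs W u w * x w) \<le> fold pivot vs W u h"
    and "supersolution R W A z \<Longrightarrow> supersolution (R - set vs) (fold pivot vs W) A z"
proof -
  have "Z_plus_on (R - set vs) (fold pivot vs W)
    \<and> (u \<in> R - set vs \<longrightarrow> w \<in> R - set vs \<longrightarrow> fold pivot vs W u w \<le> W u w)
    \<and> ((\<forall>u\<in>R. 0 \<le> W u h) \<longrightarrow> (\<forall>u\<in>R - set vs. 0 \<le> fold pivot vs W u h)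
        \<and> (\<Sum>u\<in>R - set vs. fold pivot vs W u h) \<le> (\<Sum>u\<in>R. W u h))
    \<and> ((\<forall>u\<in>R. (\<Sum>w\<in>R. W u w * x w) \<le> W u h) \<longrightarrow>
        (\<forall>u\<in>R - set vs. (\<Sum>w\<in>R - set vs. fold pivot vs W u w * x w) \<le> fold pivot vs W u h))
    \<and> (supersolution R W A z \<longrightarrow> supersolution (R - set vs) (fold pivot vs W) A z)"
    using assms
  proof (induction vs arbitrary: R W)
    case (Cons v vs)
    then have v: "v \<in> R" and Z: "Z_plus_on R W" by auto
    have R: "R - {v} - set vs = R - set (v # vs)" by auto
    have le: "u \<in> R - set (v # vs) \<Longrightarrow> w \<in> R - set (v # vs) \<Longrightarrow> pivot v W u w \<le> W u w"
      using pivot_offdiag_le[OF Z v] by simp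
    have "distinct vs" "set vs \<subseteq> R - {v}" using Cons.prems by auto
    note IH = Cons.IH[OF Z_plus_on_pivot[OF Z v] this, unfolded R]
    show ?case
      unfolding fold_Cons comp_apply
      using IH le pivot_rhs[OF Z v, of h] pivot_valid[OF Z v, of x h] supersolution_pivot[OF Z v, of A z]
      by (meson order_trans)
  qed auto
  then show "Z_plus_on (R - set vs) (fold pivot vs W)"
    and "u \<in> R - set vs \<Longrightarrow> w \<in> R - set vs \<Longrightarrow> fold pivot vs W u w \<le> W u w"
    and "\<forall>u\<in>R. 0 \<le> W u h \<Longrightarrow> \<forall>u\<in>R - set vs. 0 \<le> fold pivot vs W u h"
    and "\<forall>u\<in>R. 0 \<le> W u h \<Longrightarrow> (\<Sum>u\<in>R - set vs. fold pivot vs W u h) \<le> (\<Sum>u\<in>R. W u h)"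
    and "\<forall>u\<in>R. (\<Sum>w\<in>R. W u w * x w) \<le> W u h \<Longrightarrow>
      \<forall>u\<in>R - set vs. (\<Sum>w\<in>R - set vs. fold pivot vs W u w * x w) \<le> fold pivot vs W u h"
    and "supersolution R W A z \<Longrightarrow> supersolution (R - set vs) (fold pivot vs W) A z"
    by blast+
qed

text \<open>Back substitution: the vector for the system reduced to \<open>i\<close> alone is
  \<open>z i = 1\<close>, and each undone pivot either leaves the vector alone or assigns a value to
  the pivot variable. The set \<open>A\<close> collects \<open>i\<close> and the variables that
  received a value because some row of \<open>A\<close> involves them.\<close>

lemma ex_supersolution:
  assumes "Z_plus_on (insert i (set vs)) W" "distinct vs" "i \<notin> set vs"
  shows "\<exists>A z. i \<in> A \<and> A \<subseteq> insert i (set vs) \<and> supersolution (insert i (set vs)) W A z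
    \<and> (\<forall>w. 0 \<le> z w) \<and> z i = 1
    \<and> (\<Sum>w\<in>insert i (set vs). W i w * z w) = fold pivot vs W i i"
  using assms
proof (induction vs arbitrary: W)
  case Nil
  have "0 \<le> W i i" using Nil Z_plus_on_diag by force
  then show ?case
    by (intro exI[of _ "{i}"] exI[of _ "\<lambda>w. if w = i then 1 else 0"]) (auto simp: supersolution_def)
next
  case (Cons v vs)
  define R where "R = insert i (set (v # vs))"
  have v: "v \<in> R" "v \<noteq> i" and Z: "Z_plus_on R W" using Cons.prems by (auto simp: R_def)
  have finR: "finite R" by (simp add: R_def)
  have R: "insert i (set vs) = R - {v}" using Cons.prems by (auto simp: R_def)
  have "Z_plus_on (insert i (set vs)) (pivot v W)" unfolding R by (rule Z_plus_on_pivot[OF Z v(1)])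
  then obtain A z where A: "i \<in> A" "A \<subseteq> R - {v}" and s: "supersolution (R-{v}) (pivot v W) A z"
    and z: "\<forall>w. 0 \<le> z w" "z i = 1"
    and zi: "(\<Sum>w\<in>R-{v}. pivot v W i w * z w) = fold pivot vs (pivot v W) i i"
    using Cons.IH[of "pivot v W"] Cons.prems unfolding R by auto
  show ?case
  proof (cases "\<forall>u\<in>A. W u v = 0")
    \<comment> \<open>No row of \<open>A\<close> involves \<open>v\<close>, so the pivot changed
      none of these rows; \<open>A\<close> and \<open>z\<close> carry over.\<close>
    case True
    have eq: "(\<Sum>w\<in>R. W u w * z w) = (\<Sum>w\<in>R-{v}. pivot v W u w * z w)" if "u \<in> A" for u
      using pivot_row_sum[OF Z v(1), of u z] True that A by (simp add: subset_iff)
    have "W u w = 0" if "u \<in> A" "w \<in> R - A" for u w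
    proof (cases "w = v")
      case False
      then have "pivot v W u w = 0" using s that A by (auto simp: supersolution_def)
      then show ?thesis using True that A by (auto simp: pivot_def split: if_splits)
    qed (use True that in auto)
    then have "supersolution R W A z"
      using s A eq by (auto simp: supersolution_def)
    then show ?thesis
      using A z zi eq unfolding R_def[symmetric] by (intro exI[of _ A] exI[of _ z]) auto
  next
    case False
    then obtain u0 where u0: "u0 \<in> A" "W u0 v \<noteq> 0" by auto
    \<comment> \<open>A zero diagonal entry would make column \<open>v\<close> vanish, contrary to
      the choice of \<open>u0\<close>.\<close>
    have vv: "W v v > 0"
      using Z_plus_on_diag[OF Z v(1)] Z_plus_on_zero_column[OF Z v(1), of u0] u0 A by fastforce
    \<comment> \<open>The value at \<open>v\<close> makes row \<open>v\<close> evaluate to 0, so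
      undoing the pivot does not change the values of the rows in \<open>A\<close>. It is
      nonnegative because the off-diagonal entries of row \<open>v\<close> are nonpositive.\<close>
    define y where "y = z(v := - (\<Sum>w\<in>R-{v}. W v w * z w) / W v v)"
    have yv: "(\<Sum>w\<in>R. W v w * y w) = 0"
    proof -
      have "(\<Sum>w\<in>R. W v w * y w) = W v v * y v + (\<Sum>w\<in>R-{v}. W v w * y w)"
        using finR v by (simp add: sum.remove)
      also have "(\<Sum>w\<in>R-{v}. W v w * y w) = (\<Sum>w\<in>R-{v}. W v w * z w)"
        by (intro sum.cong) (auto simp: y_def)
      finally show ?thesis using vv by (simp add: y_def)
    qed
    have eq: "(\<Sum>w\<in>R. W u w * y w) = (\<Sum>w\<in>R-{v}. pivot v W u w * z w)" if "u \<in> A" for u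
    proof -
      have "(\<Sum>w\<in>R-{v}. pivot v W u w * z w) = (\<Sum>w\<in>R-{v}. pivot v W u w * y w)"
        by (intro sum.cong) (auto simp: y_def)
      then show ?thesis using pivot_row_sum[OF Z v(1), of u y] yv that A by (simp add: subset_iff)
    qed
    have closed: "W u w = 0 \<and> W v w = 0" if u: "u \<in> A" "W u v \<noteq> 0" and w: "w \<in> R - insert v A" for u w
    proof -
      have u': "u \<in> R" "u \<noteq> v" "u \<noteq> w" using u w A by auto
      have "pivot v W u w = 0" using s that A by (auto simp: supersolution_def)
      \<comment> \<open>The left side is nonpositive and the right side nonnegative, so both are 0;
        as \<open>W u v\<close> is nonzero, \<open>W v w\<close> vanishes too. Hence adding
        \<open>v\<close> keeps the set closed.\<close>
      then have e: "W u w = W u v / W v v * W v w" using u' by (simp add: pivot_def)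
      have "W u v < 0" using Z u u' v by (auto simp: Z_plus_on_def order.strict_iff_order)
      moreover have vw: "W v w \<le> 0" "W u w \<le> 0" using Z w v u' by (auto simp: Z_plus_on_def)
      ultimately have "0 \<le> W u v / W v v * W v w"
        using vv by (intro mult_nonpos_nonpos divide_nonpos_nonneg) auto
      then have "W u w = 0" using e vw by simp
      then show ?thesis using e u vv by auto
    qed
    have closed': "W u w = 0" if "u \<in> insert v A" "w \<in> R - insert v A" for u w
    proof (cases "u = v")
      case True then show ?thesis using closed[OF u0] that by auto
    next
      case False
      then have u: "u \<in> A" using that by auto
      show ?thesis
      proof (cases "W u v = 0")
        case True
        have "pivot v W u w = 0" using s that A u by (auto simp: supersolution_def)
        then show ?thesis using True False by (simp add: pivot_def)
      qed (use closed[OF u] that in auto)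
    qed
    have y0: "0 \<le> y w" for w
    proof -
      have "(\<Sum>w\<in>R-{v}. W v w * z w) \<le> 0"
        using Z v z by (intro sum_nonpos mult_nonpos_nonneg) (auto simp: Z_plus_on_def)
      then show ?thesis using z vv by (auto simp: y_def intro!: divide_nonpos_nonneg)
    qed
    have sA: "0 \<le> (\<Sum>w\<in>R-{v}. pivot v W u w * z w)" if "u \<in> A" for u
      using s that A by (auto simp: supersolution_def)
    have "supersolution R W (insert v A) y"
      unfolding supersolution_def
      using closed' s sA eq yv by (auto simp: supersolution_def y_def)
    moreover have "y i = 1" using z v by (simp add: y_def)
    ultimately show ?thesis
      using A zi eq v y0 yv unfolding R_def[symmetric]
      by (intro exI[of _ "insert v A"] exI[of _ y]) auto
  qed
qed

text \<open>Elimination uses only field operations, so it commutes with the embedding of the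
  rationals into the reals: the program computes over the former, while the polyhedra are sets of
  real vectors.\<close>

lemma fold_pivot_hom:
  fixes f :: "'a::field \<Rightarrow> 'b::field"
  assumes "\<And>x y. f (x - y) = f x - f y" "\<And>x y. f (x * y) = f x * f y" "\<And>x y. f (x / y) = f x / f y"
  shows "fold pivot vs (\<lambda>u w. f (W u w)) u w = f (fold pivot vs W u w)"
proof (induction vs arbitrary: W)
  case (Cons v vs)
  have "pivot v (\<lambda>u w. f (W u w)) = (\<lambda>u w. f (pivot v W u w))"
    using assms by (auto simp: pivot_def fun_eq_iff)
  then show ?case using Cons by simp
qed simp

section \<open>Reduction to two variables\<close>

definition others :: "nat \<Rightarrow> nat \<Rightarrow> nat \<Rightarrow> nat list" where
  "others n i j = filter (\<lambda>v. v \<noteq> i \<and> v \<noteq> j) [0..<n]"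

text \<open>Column \<open>n\<close> of the \<open>n\<close>-rowed array holds the right-hand side.\<close>

definition reduced :: "nat \<Rightarrow> (nat \<Rightarrow> nat \<Rightarrow> 'a::field) \<Rightarrow> nat \<Rightarrow> nat \<Rightarrow> nat \<Rightarrow> nat \<Rightarrow> 'a" where
  "reduced n W i j = fold pivot (others n i j) W"

lemma set_others: "set (others n i j) = {..<n} - {i, j}"
  by (auto simp: others_def)

lemma distinct_others: "distinct (others n i j)"
  by (simp add: others_def)

lemma others_rest: "i < n \<Longrightarrow> j < n \<Longrightarrow> {..<n} - set (others n i j) = {i, j}"
  by (auto simp: set_others)

lemmas reduced_invariants =
  fold_pivot_invariants[where vs = "others n i j" and R = "{..<n}" for n i j,
    OF _ distinct_others, folded reduced_def]

text \<open>Only the block of rows and columns \<open>i\<close> and \<open>j\<close> is left, so the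
  invariants specialize to an inequality in two variables. The lower bound on the off-diagonal entry
  comes from the nonnegative sum of column \<open>j\<close> of this block; it serves to bound the
  size of the output.\<close>

lemma
  fixes W :: "nat \<Rightarrow> nat \<Rightarrow> 'a::linordered_field"
  assumes Z: "Z_plus_on {..<n} W" and ij: "i < n" "j < n"
  shows reduced_offdiag_nonpos: "i \<noteq> j \<Longrightarrow> reduced n W i j i j \<le> 0"
    and reduced_diag_nonneg: "0 \<le> reduced n W i j i i"
    and reduced_le: "reduced n W i j i j \<le> W i j"
    and reduced_diag_le: "reduced n W i j i i \<le> W i i"
    and reduced_offdiag_ge: "- W j j \<le> reduced n W i j i j"
    and reduced_rhs_nonneg: "\<forall>u<n. 0 \<le> W u h \<Longrightarrow> 0 \<le> reduced n W i j i h"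
    and reduced_rhs_le: "\<forall>u<n. 0 \<le> W u h \<Longrightarrow> reduced n W i j i h \<le> (\<Sum>u<n. W u h)"
    and reduced_valid: "\<forall>u<n. (\<Sum>w<n. W u w * x w) \<le> W u h \<Longrightarrow>
      (\<Sum>w\<in>{i, j}. reduced n W i j i w * x w) \<le> reduced n W i j i h"
    and reduced_supersolution: "supersolution {..<n} W A z \<Longrightarrow> i \<in> A \<Longrightarrow>
      0 \<le> (\<Sum>w\<in>{i, j}. reduced n W i j i w * z w)"
proof -
  have sub: "set (others n i j) \<subseteq> {..<n}" by (auto simp: set_others)
  note inv = reduced_invariants[OF Z sub, unfolded others_rest[OF ij]]
  show nonpos: "reduced n W i j i j \<le> 0" if "i \<noteq> j"
    using inv(1) that by (auto simp: Z_plus_on_def)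
  show diag: "0 \<le> reduced n W i j i i" using Z_plus_on_diag[OF inv(1)] by simp
  show le: "reduced n W i j i j \<le> W i j" using inv(2) by simp
  show "reduced n W i j i i \<le> W i i" using inv(2) by simp
  show "- W j j \<le> reduced n W i j i j"
  proof (cases "i = j")
    case True
    then show ?thesis using diag Z_plus_on_diag[OF Z, of j] ij by simp
  next
    case False
    then have "0 \<le> reduced n W i j i j + reduced n W i j j j" using inv(1) by (simp add: Z_plus_on_def)
    moreover have "reduced n W i j j j \<le> W j j" using inv(2) by simp
    ultimately show ?thesis by linarith
  qed
  show nn: "0 \<le> reduced n W i j i h" if "\<forall>u<n. 0 \<le> W u h" using inv(3) that by simp
  show "reduced n W i j i h \<le> (\<Sum>u<n. W u h)" if "\<forall>u<n. 0 \<le> W u h"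
  proof -
    have "reduced n W i j i h \<le> (\<Sum>u\<in>{i,j}. reduced n W i j u h)"
      using inv(3) that by (intro member_le_sum) auto
    also have "\<dots> \<le> (\<Sum>u<n. W u h)" using inv(4) that by simp
    finally show ?thesis .
  qed
  show "(\<Sum>w\<in>{i, j}. reduced n W i j i w * x w) \<le> reduced n W i j i h"
    if "\<forall>u<n. (\<Sum>w<n. W u w * x w) \<le> W u h"
    using inv(5)[of x h] that by blast
  show "0 \<le> (\<Sum>w\<in>{i, j}. reduced n W i j i w * z w)" if "supersolution {..<n} W A z" "i \<in> A"
    using inv(6)[of A z] that by (auto simp: supersolution_def)
qed

text \<open>With \<open>z\<close> from \<open>ex_supersolution\<close>, constraint \<open>(i, j)\<close> is used with multiplier
  \<open>- W i j * z j / reduced n W i j i i\<close>, and constraint \<open>(i, i)\<close> with multiplier 1.\<close>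

lemma reduced_sound:
  fixes W :: "nat \<Rightarrow> nat \<Rightarrow> 'a::linordered_field"
  assumes Z: "Z_plus_on {..<n} W" and rhs: "\<forall>u<n. 0 \<le> W u h" and i: "i < n"
    and x: "\<forall>j<n. 0 \<le> x j"
    and c: "\<forall>j<n. W i j \<noteq> 0 \<longrightarrow> (\<Sum>w\<in>{i, j}. reduced n W i j i w * x w) \<le> reduced n W i j i h"
  shows "(\<Sum>w<n. W i w * x w) \<le> of_nat n * (\<Sum>u<n. W u h)"
proof -
  define S where "S = (\<Sum>u<n. W u h)"
  have S: "0 \<le> S" using rhs by (auto simp: S_def intro!: sum_nonneg)
  have split: "(\<Sum>w<n. f w) = f i + (\<Sum>w\<in>{..<n}-{i}. f w)" for f :: "nat \<Rightarrow> 'a"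
    using i by (simp add: sum.remove)
  have ins: "insert i (set (others n i i)) = {..<n}" using i by (auto simp: set_others)
  show ?thesis
  proof (cases "W i i = 0")
    case True
    \<comment> \<open>Here the system contains no constraint \<open>(i, i)\<close>; the bound holds
      because row \<open>i\<close> has no positive entry.\<close>
    have "W i w * x w \<le> 0" if "w < n" for w
      using that Z x i True by (cases "w = i") (auto simp: Z_plus_on_def intro!: mult_nonpos_nonneg)
    then have "(\<Sum>w<n. W i w * x w) \<le> 0" by (intro sum_nonpos) auto
    then show ?thesis using S by (simp add: S_def order_trans[of _ 0])
  next
    case False
    obtain A z where A: "i \<in> A" and s: "supersolution {..<n} W A z" and z: "\<And>w. 0 \<le> z w" "z i = 1"
      and zi: "(\<Sum>w<n. W i w * z w) = reduced n W i i i i"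
      using ex_supersolution[of i "others n i i" W] Z distinct_others
      unfolding ins reduced_def by (auto simp: set_others)
    \<comment> \<open>Each off-diagonal index costs at most \<open>S\<close>; with one more
      \<open>S\<close> for constraint \<open>(i, i)\<close> this explains the factor
      \<open>n\<close>.\<close>
    have bound: "- W i j * z j * x i \<le> - W i j * x j + S" if j: "j < n" "j \<noteq> i" for j
    proof -
      define a e r where "a = reduced n W i j i i" "e = - reduced n W i j i j" "r = reduced n W i j i h"
      have Wij: "W i j \<le> 0" using Z i j by (auto simp: Z_plus_on_def)
      show ?thesis
      proof (cases "W i j = 0 \<or> z j = 0")
        case True
        moreover have "W i j * x j \<le> 0" using Wij x j by (intro mult_nonpos_nonneg) auto
        ultimately show ?thesis using S by auto
      next
        case False
        then have zj: "0 < z j" and Wij': "W i j < 0" using z(1)[of j] Wij by auto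
        have e: "- W i j \<le> e" using reduced_le[OF Z i j(1)] by (simp add: a_e_r_def)
        \<comment> \<open>Row \<open>i\<close> of the two-variable block is nonnegative at
          \<open>z\<close>, and \<open>z i = 1\<close>.\<close>
        have ez: "e * z j \<le> a"
          using reduced_supersolution[OF Z i j(1) s A] j z by (simp add: a_e_r_def)
        have "0 < e * z j" using e Wij' zj by simp
        then have a: "0 < a" using ez by linarith
        have r: "0 \<le> r" "r \<le> S"
          using reduced_rhs_nonneg[OF Z i j(1) rhs] reduced_rhs_le[OF Z i j(1) rhs]
          by (auto simp: a_e_r_def S_def)
        have "i \<noteq> j" using j by simp
        then have con: "a * x i \<le> r + e * x j" using c[rule_format, OF j(1)] j False by (simp add: a_e_r_def)
        define q where "q = - W i j * z j / a"
        have q0: "0 \<le> q" using Wij' zj a by (simp add: q_def divide_nonpos_pos mult_nonpos_nonneg)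
        have qe: "q * e \<le> - W i j"
        proof -
          have "q * e = - W i j * ((e * z j) / a)" by (simp add: q_def)
          also have "\<dots> \<le> - W i j * 1"
            using ez a Wij' by (intro mult_left_mono) (auto simp: field_simps)
          finally show ?thesis by simp
        qed
        \<comment> \<open>As the multiplier is at most 1, the right-hand side contributes no more
          than \<open>S\<close>.\<close>
        have q1: "q \<le> 1"
        proof -
          have "- W i j * z j \<le> e * z j" using e zj by (intro mult_right_mono) auto
          then show ?thesis using ez a by (simp add: q_def field_simps)
        qed
        have "- W i j * z j * x i = q * (a * x i)" using a by (simp add: q_def)
        also have "\<dots> \<le> q * (r + e * x j)" using con q0 by (rule mult_left_mono)
        also have "\<dots> = q * r + q * e * x j" by (simp add: algebra_simps)
        also have "\<dots> \<le> 1 * S + (- W i j) * x j"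
          using q0 q1 qe r S x j by (intro add_mono mult_mono mult_right_mono) auto
        finally show ?thesis by simp
      qed
    qed
    have "reduced n W i i i i * x i \<le> reduced n W i i i h" using c i False by auto
    also have "\<dots> \<le> S" using reduced_rhs_le[OF Z i i rhs] by (simp add: S_def)
    finally have ii: "reduced n W i i i i * x i \<le> S" .
    \<comment> \<open>Solving row \<open>i\<close> of \<open>W z\<close> for \<open>W i i\<close>
      distributes the diagonal coefficient over the constraints: a share
      \<open>- W i j * z j\<close> goes to constraint \<open>(i, j)\<close>, the rest to
      \<open>(i, i)\<close>.\<close>
    have Wii: "W i i = reduced n W i i i i + (\<Sum>j\<in>{..<n}-{i}. - W i j * z j)"
      using zi z unfolding split by (simp add: sum_negf algebra_simps)
    have "W i i * x i = reduced n W i i i i * x i + (\<Sum>j\<in>{..<n}-{i}. - W i j * z j * x i)"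
      by (subst Wii) (simp only: distrib_right sum_distrib_right)
    also have "\<dots> \<le> S + (\<Sum>j\<in>{..<n}-{i}. - W i j * x j + S)"
      using bound ii by (intro add_mono sum_mono) auto
    also have "\<dots> = of_nat n * S - (\<Sum>j\<in>{..<n}-{i}. W i j * x j)"
    proof -
      have "of_nat n = (1 :: 'a) + of_nat (n - 1)" using i by (simp add: of_nat_diff)
      moreover have "(\<Sum>j\<in>{..<n}-{i}. - W i j * x j + S)
          = of_nat (n - 1) * S - (\<Sum>j\<in>{..<n}-{i}. W i j * x j)"
        using i by (simp add: sum_subtractf)
      ultimately show ?thesis by (simp add: algebra_simps)
    qed
    finally show ?thesis by (simp add: S_def[symmetric] split[of "\<lambda>w. W i w * x w"])
  qed
qed

section \<open>Encoding sizes\<close>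

text \<open>Since \<open>pivot\<close> also updates the rows of earlier pivots, this is Gauss-Jordan
  elimination. \<open>V\<close> collects the nonzero pivots; for \<open>u\<close> in
  \<open>V\<close> the original row is absorbed into \<open>L u u\<close>. The cleared columns turn
  the multipliers into the solution of a linear system, to which Cramer's rule applies.\<close>

lemma fold_pivot_rows:
  assumes "distinct vs"
  shows "\<exists>V L. V \<subseteq> set vs
    \<and> (\<forall>u w. fold pivot vs A u w = (if u \<in> V then 0 else A u w) + (\<Sum>v\<in>V. L u v * A v w))
    \<and> (\<forall>u. \<forall>v\<in>V. u \<noteq> v \<longrightarrow> fold pivot vs A u v = 0) \<and> (\<forall>v\<in>V. fold pivot vs A v v \<noteq> 0)"
  using assms
proof (induction vs rule: rev_induct)
  case Nil
  show ?case by (intro exI[of _ "{}"]) auto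
next
  case (snoc x vs)
  define W where "W = fold pivot vs A"
  obtain V L where V: "V \<subseteq> set vs"
    and W: "\<And>u w. W u w = (if u \<in> V then 0 else A u w) + (\<Sum>v\<in>V. L u v * A v w)"
    and off: "\<And>u v. v \<in> V \<Longrightarrow> u \<noteq> v \<Longrightarrow> W u v = 0" and diag: "\<And>v. v \<in> V \<Longrightarrow> W v v \<noteq> 0"
    using snoc unfolding W_def by auto
  have fold: "fold pivot (vs @ [x]) A = pivot x W" by (simp add: W_def)
  show ?case
  proof (cases "W x x = 0")
    case True
    show ?thesis unfolding fold pivot_zero[of W x, OF True]
      using V W off diag by (intro exI[of _ V] exI[of _ L]) auto
  next
    case False
    have x: "x \<notin> V" using V snoc.prems by auto
    have fin: "finite V" using V finite_subset by auto
    \<comment> \<open>Row \<open>x\<close> has not been a pivot row before, so it enters its own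
      representation with coefficient 1; every other row loses \<open>W u x / W x x\<close> times
      that representation.\<close>
    define L' where "L' u v = (if u = x then if v = x then 1 else L x v
      else (if v = x then - (W u x / W x x) else L u v - W u x / W x x * L x v))" for u v
    have sum1: "(\<Sum>v\<in>insert x V. L' u v * A v w) = L' u x * A x w + (\<Sum>v\<in>V. L' u v * A v w)" for u w
      using fin x by simp
    have sum2: "(\<Sum>v\<in>V. L' u v * A v w)
      = (\<Sum>v\<in>V. L u v * A v w) - (if u = x then 0 else W u x / W x x * (\<Sum>v\<in>V. L x v * A v w))" for u w
    proof -
      have "(\<Sum>v\<in>V. L' u v * A v w)
        = (\<Sum>v\<in>V. L u v * A v w - (if u = x then 0 else W u x / W x x * (L x v * A v w)))"
        using x by (intro sum.cong) (auto simp: L'_def algebra_simps)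
      then show ?thesis by (simp add: sum_subtractf sum_distrib_left)
    qed
    have "pivot x W u w = (if u \<in> insert x V then 0 else A u w) + (\<Sum>v\<in>insert x V. L' u v * A v w)" for u w
      unfolding sum1 sum2
      using x W[of u w] W[of x w] by (auto simp: pivot_def L'_def algebra_simps)
    \<comment> \<open>Row \<open>x\<close> is already 0 in the columns of \<open>V\<close>, so
      subtracting multiples of it keeps them cleared.\<close>
    moreover have xv: "W x v = 0" if "v \<in> V" for v using off[OF that, of x] x that by blast
    have "pivot x W u v = 0" if "v \<in> insert x V" "u \<noteq> v" for u v
      using that off[of v u] xv[of v] x False by (auto simp: pivot_def)
    moreover have "pivot x W v v \<noteq> 0" if "v \<in> insert x V" for v
      using that diag[of v] xv[of v] x False by (auto simp: pivot_def)
    ultimately show ?thesis unfolding fold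
      using V by (intro exI[of _ "insert x V"] exI[of _ L']) auto
  qed
qed

section \<open>Integrality and size of determinants, and denominators of the row multipliers\<close>

lemma det_Ints:
  fixes A :: "'a::comm_ring_1 mat"
  assumes "A \<in> carrier_mat n n" "\<And>i j. i < n \<Longrightarrow> j < n \<Longrightarrow> A $$ (i, j) \<in> \<int>"
  shows "det A \<in> \<int>"
proof -
  have "signof p * (\<Prod>i = 0..<n. A $$ (i, p i)) \<in> \<int>" if "p permutes {0..<n}" for p
    using assms(2) permutes_in_image[OF that] by (intro Ints_mult Ints_prod) (auto simp: sign_def)
  then show ?thesis unfolding det_def'[OF assms(1)] by (intro Ints_sum) auto
qed

lemma adj_mat_Ints:
  fixes A :: "'a::comm_ring_1 mat"
  assumes A: "A \<in> carrier_mat n n" and I: "\<And>i j. i < n \<Longrightarrow> j < n \<Longrightarrow> A $$ (i, j) \<in> \<int>"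
    and ij: "i < n" "j < n"
  shows "adj_mat A $$ (i, j) \<in> \<int>"
proof -
  have "mat_delete A j i \<in> carrier_mat (n - 1) (n - 1)"
    using A mat_delete_carrier by blast
  moreover have "mat_delete A j i $$ (a, b) \<in> \<int>" if "a < n - 1" "b < n - 1" for a b
    using that A I by (auto simp: mat_delete_def)
  ultimately have "det (mat_delete A j i) \<in> \<int>" by (rule det_Ints)
  moreover have "(- 1 :: 'a) ^ (j + i) \<in> \<int>" by (intro Ints_power Ints_minus Ints_1)
  ultimately show ?thesis using A ij by (simp add: adj_mat_def cofactor_def Ints_mult)
qed

text \<open>The Leibniz formula has \<open>fact n\<close> terms. This crude bound suffices because
  its logarithm is polynomial in \<open>n\<close> and \<open>log H\<close>.\<close>

lemma abs_det_le:
  fixes A :: "'a::linordered_idom mat"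
  assumes A: "A \<in> carrier_mat n n" and H: "\<And>i j. i < n \<Longrightarrow> j < n \<Longrightarrow> \<bar>A $$ (i, j)\<bar> \<le> H"
  shows "\<bar>det A\<bar> \<le> fact n * H ^ n"
proof -
  have "\<bar>det A\<bar> \<le> (\<Sum>p\<in>{p. p permutes {0..<n}}. \<bar>signof p * (\<Prod>i = 0..<n. A $$ (i, p i))\<bar>)"
    unfolding det_def'[OF A] by (rule sum_abs)
  also have "\<dots> \<le> (\<Sum>p\<in>{p. p permutes {0..<n}}. H ^ n)"
  proof (rule sum_mono)
    fix p assume p: "p \<in> {p. p permutes {0..<n}}"
    have "\<bar>signof p * (\<Prod>i = 0..<n. A $$ (i, p i))\<bar> = (\<Prod>i = 0..<n. \<bar>A $$ (i, p i)\<bar>)"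
      by (simp add: abs_mult abs_prod sign_def)
    also have "\<dots> \<le> (\<Prod>i = 0..<n. H)"
      using H permutes_in_image[of p "{0..<n}"] p by (intro prod_mono) auto
    finally show "\<bar>signof p * (\<Prod>i = 0..<n. A $$ (i, p i))\<bar> \<le> H ^ n" by simp
  qed
  also have "\<dots> = fact n * H ^ n" by (simp add: card_permutations[where n = n] of_nat_fact)
  finally show ?thesis .
qed

text \<open>Cramer's rule: replacing the rows of \<open>D A\<close> that did not serve as pivots by unit rows gives a
  nonsingular integer matrix whose determinant clears the denominators of all row multipliers.\<close>

lemma fold_pivot_denominator:
  fixes A :: "nat \<Rightarrow> nat \<Rightarrow> 'a::linordered_field"
  assumes vs: "distinct vs" "set vs \<subseteq> {..<n}" and D: "0 < D" and H: "1 \<le> H"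
    and int: "\<And>u w. u < n \<Longrightarrow> w \<le> n \<Longrightarrow> D * A u w \<in> \<int>"
    and bound: "\<And>u w. u < n \<Longrightarrow> w < n \<Longrightarrow> \<bar>D * A u w\<bar> \<le> H"
  shows "\<exists>q\<in>\<int>. 1 \<le> q \<and> q \<le> fact n * H ^ n \<and>
    (\<forall>u<n. \<forall>w\<le>n. u \<notin> set vs \<longrightarrow> D * q * fold pivot vs A u w \<in> \<int>)"
proof -
  define W where "W = fold pivot vs A"
  obtain V L where V: "V \<subseteq> set vs"
    and W': "\<forall>u w. W u w = (if u \<in> V then 0 else A u w) + (\<Sum>v\<in>V. L u v * A v w)"
    and off': "\<forall>u. \<forall>v\<in>V. u \<noteq> v \<longrightarrow> W u v = 0" and diag: "\<forall>v\<in>V. W v v \<noteq> 0"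
    using fold_pivot_rows[OF vs(1), of A] unfolding W_def[symmetric] by blast
  note W = W'[rule_format] and off = off'[rule_format]
  have Vn: "V \<subseteq> {0..<n}" using V vs by auto
  then have fin: "finite V" using finite_subset by blast
  have splitV: "(\<Sum>u = 0..<n. f u) = (\<Sum>u\<in>V. f u) + (\<Sum>u\<in>{0..<n}-V. f u)" for f :: "nat \<Rightarrow> 'a"
    using sum.subset_diff[OF Vn, of f] by (simp add: add.commute)
  define N where "N = mat n n (\<lambda>(u, w). if u \<in> V then D * A u w else if u = w then 1 else 0)"
  have N: "N \<in> carrier_mat n n" by (simp add: N_def)
  have NI: "N $$ (u, w) \<in> \<int>" if "u < n" "w < n" for u w
    using that int by (auto simp: N_def)
  have "\<bar>N $$ (u, w)\<bar> \<le> H" if "u < n" "w < n" for u w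
    using that bound H by (auto simp: N_def)
  then have detle: "\<bar>det N\<bar> \<le> fact n * H ^ n" by (rule abs_det_le[OF N])
  have "det N \<noteq> 0"
  proof
    assume "det N = 0"
    then obtain x where x: "x \<in> carrier_vec n" "x \<noteq> 0\<^sub>v n" "N *\<^sub>v x = 0\<^sub>v n"
      using det_0_iff_vec_prod_zero[OF N] by auto
    have row: "(\<Sum>w = 0..<n. N $$ (u, w) * x $ w) = 0" if "u < n" for u
    proof -
      have "(N *\<^sub>v x) $ u = 0" using x that by simp
      then show ?thesis using that N x(1) by (simp add: scalar_prod_def)
    qed
    have x0: "x $ u = 0" if "u < n" "u \<notin> V" for u
    proof -
      have "(\<Sum>w = 0..<n. N $$ (u, w) * x $ w) = (\<Sum>w = 0..<n. if u = w then x $ w else 0)"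
        using that by (intro sum.cong) (auto simp: N_def)
      then show ?thesis using row[OF that(1)] that by simp
    qed
    have Ax: "(\<Sum>w = 0..<n. A v w * x $ w) = 0" if "v \<in> V" for v
    proof -
      have "(\<Sum>w = 0..<n. N $$ (v, w) * x $ w) = D * (\<Sum>w = 0..<n. A v w * x $ w)"
        unfolding sum_distrib_left using that Vn by (intro sum.cong) (auto simp: N_def)
      then show ?thesis using row[of v] that Vn D by auto
    qed
    \<comment> \<open>The row \<open>W v\<close> is a combination of the rows of \<open>A\<close> in
      \<open>V\<close>, all of which annihilate \<open>x\<close>. On \<open>V\<close>, where
      \<open>x\<close> is supported, \<open>W v\<close> has only its nonzero diagonal entry.\<close>
    have "x $ v = 0" if v: "v \<in> V" for v
    proof -
      have "(\<Sum>w = 0..<n. W v w * x $ w) = (\<Sum>w = 0..<n. \<Sum>v'\<in>V. L v v' * (A v' w * x $ w))"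
        using v by (intro sum.cong) (auto simp: W sum_distrib_right mult.assoc)
      also have "\<dots> = (\<Sum>v'\<in>V. L v v' * (\<Sum>w = 0..<n. A v' w * x $ w))"
        by (subst sum.swap) (simp add: sum_distrib_left)
      also have "\<dots> = 0" using Ax by simp
      finally have "(\<Sum>w = 0..<n. W v w * x $ w) = 0" .
      moreover have "(\<Sum>w = 0..<n. W v w * x $ w) = (\<Sum>w = 0..<n. if w = v then W v v * x $ v else 0)"
        using off x0 by (intro sum.cong) fastforce+
      ultimately show ?thesis using diag v Vn by auto
    qed
    then have "x = 0\<^sub>v n" using x0 x(1) by (intro eq_vecI) auto
    then show False using x by simp
  qed
  have lam: "det N * L i v \<in> \<int>" if i: "i < n" "i \<notin> V" and v: "v \<in> V" for i v
  proof -
    \<comment> \<open>The equation for row \<open>W i\<close>, rearranged, says that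
      \<open>y\<close> solves \<open>y N = - A i\<close>: dividing by \<open>D\<close> undoes the
      scaling of the pivot rows, and the unit rows supply the entries of \<open>W i\<close> outside
      \<open>V\<close>. Multiplying by the adjugate then isolates
      \<open>det N * y v\<close>.\<close>
    define y where "y u = (if u \<in> V then L i u / D else - W i u)" for u
    have yN: "(\<Sum>u = 0..<n. y u * N $$ (u, w)) = - A i w" if w: "w < n" for w
    proof -
      have "(\<Sum>u\<in>V. y u * N $$ (u, w)) = (\<Sum>u\<in>V. L i u * A u w)"
        using Vn w D by (intro sum.cong) (auto simp: y_def N_def)
      moreover have "(\<Sum>u\<in>{0..<n}-V. y u * N $$ (u, w)) = (\<Sum>u\<in>{0..<n}-V. if u = w then - W i w else 0)"
        using w by (intro sum.cong) (auto simp: y_def N_def)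
      moreover have "\<dots> = (if w \<in> V then 0 else - W i w)" using w by (simp add: sum.delta)
      moreover have "w \<in> V \<Longrightarrow> W i w = 0" using off' i by auto
      ultimately show ?thesis unfolding splitV using W[of i w] i by auto
    qed
    have vn: "v < n" using v Vn by auto
    have adj: "(\<Sum>w = 0..<n. N $$ (u, w) * adj_mat N $$ (w, v)) = (if u = v then det N else 0)" if "u < n" for u
    proof -
      have "(N * adj_mat N) $$ (u, v) = (det N \<cdot>\<^sub>m 1\<^sub>m n) $$ (u, v)" using adj_mat(2)[OF N] by simp
      then show ?thesis using that vn N adj_mat(1)[OF N] by (simp add: scalar_prod_def)
    qed
    have "(\<Sum>w = 0..<n. - A i w * adj_mat N $$ (w, v))
      = (\<Sum>w = 0..<n. \<Sum>u = 0..<n. y u * (N $$ (u, w) * adj_mat N $$ (w, v)))"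
      by (intro sum.cong) (auto simp: yN[symmetric] sum_distrib_right mult.assoc)
    also have "\<dots> = (\<Sum>u = 0..<n. y u * (\<Sum>w = 0..<n. N $$ (u, w) * adj_mat N $$ (w, v)))"
      by (subst sum.swap) (simp add: sum_distrib_left)
    also have "\<dots> = (\<Sum>u = 0..<n. if u = v then y v * det N else 0)"
      using adj by (intro sum.cong) auto
    also have "\<dots> = y v * det N" using vn by simp
    finally have "det N * L i v = D * (\<Sum>w = 0..<n. - A i w * adj_mat N $$ (w, v))"
      using v D by (simp add: y_def)
    also have "\<dots> = (\<Sum>w = 0..<n. - (D * A i w) * adj_mat N $$ (w, v))"
      by (simp add: sum_distrib_left mult.assoc)
    also have "\<dots> \<in> \<int>"
      using i int vn adj_mat_Ints[OF N NI] by (intro Ints_sum Ints_mult[OF Ints_minus]) auto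
    finally show ?thesis .
  qed
  \<comment> \<open>The multipliers were cleared using columns below \<open>n\<close> alone, so the
    same determinant also works for the right-hand side in column \<open>n\<close>.\<close>
  have "D * det N * W u w \<in> \<int>" if u: "u < n" "u \<notin> set vs" and w: "w \<le> n" for u w
  proof -
    have uV: "u \<notin> V" using u V by auto
    have "D * det N * W u w = det N * (D * A u w) + (\<Sum>v\<in>V. det N * L u v * (D * A v w))"
      using uV by (simp add: W distrib_left sum_distrib_left mult_ac)
    also have "\<dots> \<in> \<int>"
    proof (intro Ints_add Ints_sum)
      show "det N * (D * A u w) \<in> \<int>" using u w by (intro Ints_mult[OF det_Ints[OF N NI] int])
      show "det N * L u v * (D * A v w) \<in> \<int>" if "v \<in> V" for v
        using that Vn u uV w by (intro Ints_mult[OF lam int]) auto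
    qed
    finally show ?thesis .
  qed
  moreover have "\<bar>det N\<bar> \<in> \<int>" using det_Ints[OF N NI] by auto
  moreover have "1 \<le> \<bar>det N\<bar>"
    using \<open>det N \<noteq> 0\<close> \<open>\<bar>det N\<bar> \<in> \<int>\<close> by (metis Ints_nonzero_abs_ge1 abs_abs abs_eq_0)
  ultimately show ?thesis
    using detle unfolding W_def by (intro bexI[of _ "\<bar>det N\<bar>"]) (auto simp: abs_if)
qed

section \<open>From encoding sizes to magnitudes and back\<close>

lemma enc_rat_ge:
  assumes "quotient_of r = (p, q)"
  shows "of_int q \<le> (2 :: rat) ^ enc_rat r" "\<bar>r\<bar> \<le> 2 ^ enc_rat r" "1 \<le> enc_rat r"
proof -
  have q: "q > 0" using assms quotient_of_denom_pos by blast
  have le: "x + 1 \<le> 2 ^ m" if x: "0 \<le> x" "nat \<lceil>log 2 (of_int (x + 1))\<rceil> \<le> m" for x :: int and m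
  proof -
    have "log 2 (of_int (x + 1)) \<le> real m" using x(2) by linarith
    then have "of_int (x + 1) \<le> (2 :: real) powr m" using x by (simp add: log_le_iff)
    then have "of_int (x + 1) \<le> (of_int (2 ^ m) :: real)" by (simp add: powr_realpow)
    then show ?thesis by (simp only: of_int_le_iff)
  qed
  have "y \<le> 1 + x + y" "x \<le> 1 + x + y" for x y :: nat by auto
  then have "nat \<lceil>log 2 (of_int (q + 1))\<rceil> \<le> enc_rat r" "nat \<lceil>log 2 (of_int (\<bar>p\<bar> + 1))\<rceil> \<le> enc_rat r"
    unfolding enc_rat_def assms prod.case by blast+
  then have "q + 1 \<le> 2 ^ enc_rat r" "\<bar>p\<bar> + 1 \<le> 2 ^ enc_rat r"
    using q by (auto intro!: le simp del: of_int_add)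
  then have p: "\<bar>p\<bar> \<le> 2 ^ enc_rat r" and q2: "q \<le> 2 ^ enc_rat r" by auto
  have "of_int q \<le> (of_int (2 ^ enc_rat r) :: rat)" using q2 by (simp only: of_int_le_iff)
  then show "of_int q \<le> (2 :: rat) ^ enc_rat r" by simp
  have "\<bar>r\<bar> = of_int \<bar>p\<bar> / of_int q" using quotient_of_div[OF assms] q by simp
  also have "\<dots> \<le> of_int \<bar>p\<bar> / 1" using q by (intro divide_left_mono) auto
  also have "\<dots> \<le> (of_int (2 ^ enc_rat r) :: rat)" using p by (simp only: of_int_le_iff div_by_1)
  finally show "\<bar>r\<bar> \<le> 2 ^ enc_rat r" by simp
  show "1 \<le> enc_rat r" by (simp add: enc_rat_def assms)
qed

text \<open>A positive integer \<open>d\<close> that clears the denominator is a multiple of the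
  denominator in lowest terms, which is therefore at most \<open>2 ^ c\<close>; the numerator is
  then at most \<open>2 ^ (a + c)\<close>. Of the extra 3, each logarithm accounts for 1 and the
  constant in \<open>enc_rat\<close> for the last.\<close>

lemma enc_rat_le:
  assumes d: "d \<in> \<int>" "0 < d" "d \<le> 2 ^ c" and dr: "d * r \<in> \<int>" and r: "\<bar>r\<bar> \<le> 2 ^ a"
  shows "enc_rat r \<le> a + 2 * c + 3"
proof -
  obtain p q where pq: "quotient_of r = (p, q)" by fastforce
  have q: "q > 0" using pq quotient_of_denom_pos by blast
  have co: "coprime p q" using pq quotient_of_coprime by blast
  have r_eq: "r = of_int p / of_int q" using pq quotient_of_div by blast
  obtain e m where e: "d = of_int e" and m: "d * r = of_int m"
    using d(1) dr by (auto elim!: Ints_cases)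
  have "of_int (e * p) = (of_int (m * q) :: rat)" using m q unfolding e r_eq by (simp add: field_simps)
  then have "e * p = m * q" by (simp only: of_int_eq_iff)
  then have "q dvd e * p" by simp
  then have "q dvd e" using co by (simp add: coprime_commute coprime_dvd_mult_left_iff)
  moreover have "0 < e" using d(2) e by simp
  ultimately have "q \<le> e" by (rule zdvd_imp_le)
  moreover have "e \<le> 2 ^ c"
  proof -
    have "of_int e \<le> (of_int (2 ^ c) :: rat)" using d(3) e by simp
    then show ?thesis by (simp only: of_int_le_iff)
  qed
  ultimately have qc: "q \<le> 2 ^ c" by simp
  have qc': "of_int q \<le> (of_int (2 ^ c) :: rat)" using qc by (simp only: of_int_le_iff)
  have "of_int \<bar>p\<bar> = \<bar>r\<bar> * of_int q" using r_eq q by simp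
  also have "\<dots> \<le> 2 ^ a * of_int (2 ^ c)"
    using r qc' q by (intro mult_mono) auto
  also have "\<dots> = of_int (2 ^ (a + c))" by (simp add: power_add)
  finally have pc: "\<bar>p\<bar> \<le> 2 ^ (a + c)" by (simp only: of_int_le_iff)
  have le: "nat \<lceil>log 2 (of_int (x + 1))\<rceil> \<le> m + 1" if x: "0 \<le> x" "x \<le> 2 ^ m" for x :: int and m
  proof -
    have "x + 1 \<le> 2 ^ (m + 1)" using x one_le_power[of "2 :: int" m] unfolding power_add power_one_right by linarith
    then have "of_int (x + 1) \<le> (of_int (2 ^ (m + 1)) :: real)" by (simp only: of_int_le_iff)
    then have "log 2 (of_int (x + 1)) \<le> log 2 ((2 :: real) ^ (m + 1))"
      using x by (intro log_mono) auto
    also have "\<dots> = m + 1" by (subst log_nat_power) auto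
    finally show ?thesis by linarith
  qed
  have "nat \<lceil>log 2 (of_int (\<bar>p\<bar> + 1))\<rceil> \<le> a + c + 1" "nat \<lceil>log 2 (of_int (q + 1))\<rceil> \<le> c + 1"
    using le[OF _ pc] le[OF _ qc] q by (auto simp del: of_int_add)
  then show ?thesis unfolding enc_rat_def pq prod.case by linarith
qed

text \<open>With \<open>D\<close> the product of all denominators and \<open>q\<close> the
  determinant from Cramer's rule, \<open>D * q\<close> clears row \<open>i\<close> and is at most
  \<open>2 ^ (E + 3 * E ^ 2)\<close>. The magnitudes are bounded by \<open>2 ^ (2 * E)\<close>, and
  \<open>enc_rat_le\<close> combines the two bounds.\<close>

lemma enc_reduced:
  fixes A :: "nat \<Rightarrow> nat \<Rightarrow> rat"
  assumes Z: "Z_plus_on {..<n} A" and rhs: "\<forall>u<n. 0 \<le> A u n" and ij: "i < n" "j < n"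
    and E: "(\<Sum>u<n. \<Sum>w\<le>n. enc_rat (A u w)) \<le> E" and w: "w \<in> {i, j, n}"
  shows "enc_rat (reduced n A i j i w) \<le> 6 * E\<^sup>2 + 4 * E + 3"
proof -
  have entry: "enc_rat (A u w) \<le> E" if "u < n" "w \<le> n" for u w
  proof -
    have "enc_rat (A u w) \<le> (\<Sum>w\<le>n. enc_rat (A u w))" using that by (intro member_le_sum) auto
    also have "\<dots> \<le> (\<Sum>u<n. \<Sum>w\<le>n. enc_rat (A u w))" using that by (intro member_le_sum) auto
    finally show ?thesis using E by simp
  qed
  have A: "\<bar>A u w\<bar> \<le> 2 ^ E" if "u < n" "w \<le> n" for u w
  proof -
    obtain p q where "quotient_of (A u w) = (p, q)" by fastforce
    note enc_rat_ge(2)[OF this]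
    also have "(2 :: rat) ^ enc_rat (A u w) \<le> 2 ^ E" using entry[OF that] by (intro power_increasing) auto
    finally show ?thesis .
  qed
  \<comment> \<open>Each of the \<open>n * (n + 1)\<close> entries has size at least 1, so
    \<open>E\<close> also controls the dimension.\<close>
  have nE: "n \<le> E"
  proof -
    have "(\<Sum>u<n. \<Sum>w\<le>n. 1) \<le> (\<Sum>u<n. \<Sum>w\<le>n. enc_rat (A u w))"
      using enc_rat_ge(3) by (intro sum_mono) (metis surj_pair)
    then have "n * (n + 1) \<le> E" using E by simp
    moreover have "n \<le> n * (n + 1)" by simp
    ultimately show ?thesis by (rule order_trans[rotated])
  qed
  define den where "den u w = snd (quotient_of (A u w))" for u w
  have den0: "0 < den u w" for u w unfolding den_def by (metis prod.collapse quotient_of_denom_pos)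
  have den_le: "of_int (den u w) \<le> (2 :: rat) ^ enc_rat (A u w)" for u w
    unfolding den_def by (rule enc_rat_ge(1)[of _ "fst (quotient_of (A u w))"]) simp
  define D where "D = (\<Prod>u<n. \<Prod>w\<le>n. den u w)"
  have D0: "0 < D" unfolding D_def by (intro prod_pos) (auto simp: den0)
  have "of_int D \<le> (2 :: rat) ^ E"
  proof -
    have "of_int D = (\<Prod>u<n. \<Prod>w\<le>n. (of_int (den u w) :: rat))" by (simp add: D_def)
    also have "\<dots> \<le> (\<Prod>u<n. \<Prod>w\<le>n. 2 ^ enc_rat (A u w))"
      using den_le by (intro prod_mono conjI prod_nonneg) (auto simp: less_imp_le[OF den0])
    also have "\<dots> = 2 ^ (\<Sum>u<n. \<Sum>w\<le>n. enc_rat (A u w))" by (simp add: power_sum)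
    also have "\<dots> \<le> 2 ^ E" using E by (intro power_increasing) auto
    finally show ?thesis .
  qed
  have DA: "of_int D * A u w \<in> \<int>" if "u < n" "w \<le> n" for u w
  proof -
    have "den u w dvd D" unfolding D_def using that
      by (intro dvd_trans[OF dvd_prodI dvd_prodI[of "{..<n}" u "\<lambda>u. \<Prod>w\<le>n. den u w"]]) auto
    then obtain m where m: "D = den u w * m" by blast
    obtain p q where pq: "quotient_of (A u w) = (p, q)" by fastforce
    have "A u w = of_int p / of_int (den u w)" using quotient_of_div[OF pq] pq by (simp add: den_def)
    then have "of_int D * A u w = of_int (m * p)" using den0[of u w] by (simp add: m)
    then show ?thesis by (metis Ints_of_int)
  qed
  have bound: "\<bar>of_int D * A u w\<bar> \<le> 2 ^ (2 * E)" if "u < n" "w < n" for u w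
  proof -
    have "\<bar>of_int D * A u w\<bar> \<le> 2 ^ E * 2 ^ E"
      unfolding abs_mult using A that D0 \<open>of_int D \<le> 2 ^ E\<close> by (intro mult_mono) auto
    then show ?thesis by (simp add: mult_2 power_add)
  qed
  obtain q where q: "q \<in> \<int>" "1 \<le> q" "q \<le> fact n * (2 ^ (2 * E)) ^ n"
    and Dq: "\<And>w. w \<le> n \<Longrightarrow> of_int D * q * reduced n A i j i w \<in> \<int>"
    using fold_pivot_denominator[where vs = "others n i j" and n = n and D = "of_int D"
        and H = "2 ^ (2 * E)" and A = A, OF distinct_others]
      D0 DA bound ij unfolding reduced_def by (auto simp: set_others)
  have "q \<le> 2 ^ (E * E) * 2 ^ (2 * E * E)"
  proof -
    have "fact n \<le> (of_nat (n ^ n) :: rat)" by (rule fact_le_power)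
    also have "\<dots> \<le> of_nat ((2 ^ E) ^ E)"
    proof -
      have "n ^ n \<le> (2 ^ E) ^ n" using nE by (intro power_mono) (auto intro: order_trans less_imp_le[OF less_exp])
      also have "\<dots> \<le> (2 ^ E) ^ E" using nE by (intro power_increasing) auto
      finally show ?thesis by (simp only: of_nat_le_iff)
    qed
    finally have "fact n \<le> (2 :: rat) ^ (E * E)" by (simp add: power_mult)
    moreover have "(2 ^ (2 * E)) ^ n \<le> (2 :: rat) ^ (2 * E * E)"
      unfolding power_mult[symmetric] using nE by (intro power_increasing) auto
    ultimately have "fact n * (2 ^ (2 * E)) ^ n \<le> (2 :: rat) ^ (E * E) * 2 ^ (2 * E * E)"
      by (intro mult_mono) auto
    then show ?thesis using q by linarith
  qed
  then have "of_int D * q \<le> 2 ^ E * (2 ^ (E * E) * 2 ^ (2 * E * E))"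
    using \<open>of_int D \<le> 2 ^ E\<close> q by (intro mult_mono) auto
  then have Dq_le: "of_int D * q \<le> 2 ^ (E + 3 * E\<^sup>2)"
    by (simp flip: power_add add: power2_eq_square algebra_simps)
  show "enc_rat (reduced n A i j i w) \<le> 6 * E\<^sup>2 + 4 * E + 3"
  proof -
    have AE: "\<bar>A u w\<bar> \<le> 2 ^ (2 * E)" if "u < n" "w \<le> n" for u w
      using A[OF that] by (rule order_trans) (simp add: power_increasing)
    \<comment> \<open>Signs give more than determinants would: the right-hand side lies between 0
      and the sum of the original ones, the diagonal entry between 0 and \<open>A i i\<close>, and
      the off-diagonal entry between \<open>- A j j\<close> and 0.\<close>
    have "\<bar>reduced n A i j i w\<bar> \<le> 2 ^ (2 * E)"
    proof (cases "w = n")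
      case True
      have "reduced n A i j i n \<le> (\<Sum>u<n. A u n)" by (rule reduced_rhs_le[OF Z ij rhs])
      also have "\<dots> \<le> (\<Sum>u<n. 2 ^ E)" using A by (intro sum_mono) (auto simp: abs_le_iff)
      also have "\<dots> = of_nat n * 2 ^ E" by simp
      also have "\<dots> \<le> 2 ^ E * 2 ^ E"
      proof (intro mult_right_mono)
        have "n \<le> 2 ^ E" using nE less_exp[of E] by linarith
        then show "of_nat n \<le> (2 :: rat) ^ E" by (metis of_nat_le_iff of_nat_numeral of_nat_power)
      qed simp
      finally show ?thesis using reduced_rhs_nonneg[OF Z ij rhs] True by (simp add: mult_2 power_add)
    next
      case False
      show ?thesis
      proof (cases "w = i")
        case True
        then show ?thesis
          using reduced_diag_nonneg[OF Z ij] reduced_diag_le[OF Z ij] AE[of i i] ij by simp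
      next
        case False
        then have "w = j" "i \<noteq> j" using w \<open>w \<noteq> n\<close> by auto
        then show ?thesis
          using reduced_offdiag_nonpos[OF Z ij] reduced_offdiag_ge[OF Z ij] AE[of j j] ij by simp
      qed
    qed
    moreover have "w \<le> n" using w ij by auto
    ultimately have "enc_rat (reduced n A i j i w) \<le> 2 * E + 2 * (E + 3 * E\<^sup>2) + 3"
      using q D0 Dq Dq_le by (intro enc_rat_le) (auto intro: Ints_mult mult_pos_pos)
    then show ?thesis by simp
  qed
qed

section \<open>The program and its running time\<close>

text \<open>Total correctness from one start store. The time is bounded from above so that branches
  of different cost can share one estimate.\<close>

definition runs :: "com \<Rightarrow> store \<Rightarrow> nat \<Rightarrow> (store \<Rightarrow> bool) \<Rightarrow> bool" where
  "runs c s T Q \<longleftrightarrow> (\<exists>n s'. exec c s n s' \<and> n \<le> T \<and> Q s')"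

lemma runs_weaken:
  assumes "runs c s T Q" "T \<le> T'" "\<And>s'. Q s' \<Longrightarrow> Q' s'"
  shows "runs c s T' Q'"
  using assms unfolding runs_def by (meson order_trans)

lemma runs_Skip: "Q s \<Longrightarrow> 1 \<le> T \<Longrightarrow> runs Skip s T Q"
  unfolding runs_def using exec.Skip by blast

lemma runs_NAssign:
  assumes "Q (s\<lparr>nats := upd (nats s) x (map (nval s) es) (nval s e)\<rparr>)"
    and "1 + sum_list (map ncost es) + ncost e \<le> T"
  shows "runs (NAssign x es e) s T Q"
  unfolding runs_def using assms exec.NAssign by blast

lemma runs_QAssign:
  assumes "Q (s\<lparr>rats := upd (rats s) x (map (nval s) es) (qval s e)\<rparr>)"
    and "1 + sum_list (map ncost es) + qcost e \<le> T"
  shows "runs (QAssign x es e) s T Q"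
  unfolding runs_def using assms exec.QAssign by blast

text \<open>The postcondition of the first program is the whole claim about the second, as in a
  weakest-precondition calculus, so no intermediate assertion has to be named.\<close>

lemma runs_Seq:
  assumes "runs c s T1 (\<lambda>s'. runs d s' T2 Q)"
  shows "runs (Seq c d) s (T1 + T2) Q"
  using assms unfolding runs_def by (meson exec.Seq add_mono)

lemma runs_Cond:
  assumes "bval s g \<Longrightarrow> runs c s T Q" "\<not> bval s g \<Longrightarrow> runs d s T Q"
  shows "runs (Cond g c d) s (1 + bcost g + T) Q"
proof (cases "bval s g")
  case True
  then obtain n s' where "exec c s n s'" "n \<le> T" "Q s'" using assms unfolding runs_def by blast
  then show ?thesis unfolding runs_def using exec.CondTrue[OF True, of c n s' d] by (meson add_left_mono)
next
  case False
  then obtain n s' where "exec d s n s'" "n \<le> T" "Q s'" using assms unfolding runs_def by blast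
  then show ?thesis unfolding runs_def using exec.CondFalse[OF False, of d n s' c] by (meson add_left_mono)
qed

section \<open>Counting loops and framing\<close>

abbreviation nv :: "string \<Rightarrow> nexp" where
  "nv x \<equiv> NVar x []"

definition For :: "string \<Rightarrow> nexp \<Rightarrow> com \<Rightarrow> com" where
  "For x e c = Seq (NAssign x [] (NConst 0))
    (While (NLess (nv x) e) (Seq c (NAssign x [] (NPlus (nv x) (NConst 1)))))"

definition set_nat :: "string \<Rightarrow> nat \<Rightarrow> store \<Rightarrow> store" where
  "set_nat x v s = s\<lparr>nats := upd (nats s) x [] v\<rparr>"

text \<open>The bound \<open>e\<close> is evaluated at every test, so the invariant must fix its
  value. Initialization costs 2 and the failing test \<open>ncost e + 3\<close>; each iteration adds
  a test and 4 units for the increment.\<close>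

lemma runs_For:
  assumes init: "I 0 (set_nat x 0 s)"
    and step: "\<And>m s. m < n \<Longrightarrow> I m s \<Longrightarrow> nats s x [] = m \<Longrightarrow>
      runs c s (T m) (\<lambda>s'. nats s' x [] = m \<and> I (Suc m) (set_nat x (Suc m) s'))"
    and e: "\<And>m s. I m s \<Longrightarrow> nval s e = n"
    and Q: "\<And>s'. I n s' \<Longrightarrow> Q s'"
  shows "runs (For x e c) s (ncost e + 5 + (\<Sum>m<n. T m + ncost e + 7)) Q"
proof -
  let ?body = "Seq c (NAssign x [] (NPlus (nv x) (NConst 1)))"
  let ?w = "While (NLess (nv x) e) ?body"
  \<comment> \<open>The induction is on the number \<open>d\<close> of remaining iterations.\<close>
  have loop: "runs ?w s (ncost e + 3 + (\<Sum>m=n-d..<n. T m + ncost e + 7)) Q"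
    if "d \<le> n" "I (n - d) s" "nats s x [] = n - d" for d s
    using that
  proof (induction d arbitrary: s)
    case 0
    then have "exec ?w s (1 + bcost (NLess (nv x) e)) s"
      by (intro exec.WhileFalse) (simp add: e[OF 0(2)])
    then show ?case using Q 0 unfolding runs_def by (intro exI conjI) auto
  next
    case (Suc d)
    define m where "m = n - Suc d"
    have m: "m < n" "n - d = Suc m" using Suc.prems by (auto simp: m_def)
    have I: "I m s" "nats s x [] = m" using Suc.prems by (auto simp: m_def)
    obtain k s1 where k: "exec c s k s1" "k \<le> T m" "nats s1 x [] = m" "I (Suc m) (set_nat x (Suc m) s1)"
      using step[OF m(1) I] unfolding runs_def by blast
    have "exec ?body s (k + 4) (set_nat x (Suc m) s1)"
      using exec.Seq[OF k(1) exec.NAssign[of x "[]" "NPlus (nv x) (NConst 1)" s1]] k(3)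
      by (simp add: set_nat_def eval_nat_numeral)
    moreover have "nats (set_nat x (Suc m) s1) x [] = Suc m" by (simp add: set_nat_def upd_def)
    then obtain k' s2 where k': "exec ?w (set_nat x (Suc m) s1) k' s2"
      "k' \<le> ncost e + 3 + (\<Sum>m=n-d..<n. T m + ncost e + 7)" "Q s2"
      using Suc.IH[of "set_nat x (Suc m) s1"] k(4) m Suc.prems(1) unfolding runs_def by auto
    ultimately have "exec ?w s (1 + bcost (NLess (nv x) e) + (k + 4) + k') s2"
      using m by (intro exec.WhileTrue[OF _ _ k'(1)]) (auto simp: e[OF I(1)] I(2))
    moreover have "(\<Sum>i=m..<n. T i + ncost e + 7) = (T m + ncost e + 7) + (\<Sum>i=Suc m..<n. T i + ncost e + 7)"
      using m by (simp add: sum.atLeast_Suc_lessThan)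
    ultimately show ?case
      using k(2) k' m unfolding runs_def m_def[symmetric] by (intro exI conjI) auto
  qed
  have "runs ?w (set_nat x 0 s) (ncost e + 3 + (\<Sum>m=n-n..<n. T m + ncost e + 7)) Q"
    using loop[of n "set_nat x 0 s"] init by (simp add: set_nat_def upd_def)
  then have "runs (For x e c) s (2 + (ncost e + 3 + (\<Sum>m=n-n..<n. T m + ncost e + 7))) Q"
    unfolding For_def by (intro runs_Seq runs_NAssign) (auto simp: set_nat_def)
  then show ?thesis by (simp add: atLeast0LessThan algebra_simps)
qed

text \<open>A frame condition: \<open>X\<close> lists the names that may have changed. One name
  covers both the index array and the rational array it denotes.\<close>

definition agree :: "string set \<Rightarrow> store \<Rightarrow> store \<Rightarrow> bool" where
  "agree X s s' \<longleftrightarrow> (\<forall>y. y \<notin> X \<longrightarrow> nats s' y = nats s y \<and> rats s' y = rats s y)"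

lemma agree_refl: "agree X s s"
  by (simp add: agree_def)

lemma agree_trans: "agree X s s' \<Longrightarrow> agree Y s' s'' \<Longrightarrow> X \<subseteq> Z \<Longrightarrow> Y \<subseteq> Z \<Longrightarrow> agree Z s s''"
  unfolding agree_def by (metis subsetD)

lemma agree_nats: "agree X s s' \<Longrightarrow> y \<notin> X \<Longrightarrow> nats s' y = nats s y"
  and agree_rats: "agree X s s' \<Longrightarrow> y \<notin> X \<Longrightarrow> rats s' y = rats s y"
  by (auto simp: agree_def)

lemma agree_nats_upd: "x \<in> X \<Longrightarrow> agree X s (s'\<lparr>nats := (nats s')(x := f)\<rparr>) \<longleftrightarrow> agree X s s'"
  and agree_rats_upd: "x \<in> X \<Longrightarrow> agree X s (s'\<lparr>rats := (rats s')(x := g)\<rparr>) \<longleftrightarrow> agree X s s'"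
  unfolding agree_def by auto

lemma agree_set_nat: "x \<in> X \<Longrightarrow> agree X s (set_nat x v s') \<longleftrightarrow> agree X s s'"
  by (simp add: set_nat_def upd_def agree_nats_upd)

lemma rats_set_nat [simp]: "rats (set_nat x v s) = rats s"
  by (simp add: set_nat_def)

lemma nats_set_nat: "nats (set_nat x v s) y = (if y = x then (nats s x)([] := v) else nats s y)"
  by (simp add: set_nat_def upd_def)

section \<open>Programs for one elimination and their running times\<close>

definition prog_row :: com where
  "prog_row = For ''w'' (NPlus (nv ''n'') (NConst 1))
    (QAssign ''W'' [nv ''u'', nv ''w'']
      (QMinus (QVar ''W'' [nv ''u'', nv ''w''])
        (QTimes (QVar ''f'' []) (QVar ''W'' [nv ''v'', nv ''w'']))))"

lemma runs_prog_row:
  assumes s: "nats s ''n'' [] = n" "nats s ''u'' [] = u" "nats s ''v'' [] = v" and uv: "u \<noteq> v"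
  shows "runs prog_row s (30 * (n + 1)) (\<lambda>s'. agree {''w'', ''W''} s s' \<and>
    (\<forall>a w. rats s' ''W'' [a, w] = (if a = u \<and> w \<le> n
      then rats s ''W'' [a, w] - rats s ''f'' [] * rats s ''W'' [v, w] else rats s ''W'' [a, w])))"
proof -
  define I where "I m s' \<longleftrightarrow> agree {''w'', ''W''} s s' \<and>
    (\<forall>a w. rats s' ''W'' [a, w] = (if a = u \<and> w < m
      then rats s ''W'' [a, w] - rats s ''f'' [] * rats s ''W'' [v, w] else rats s ''W'' [a, w]))" for m s'
  have "runs prog_row s (ncost (NPlus (nv ''n'') (NConst 1)) + 5
      + (\<Sum>m<n+1. 12 + ncost (NPlus (nv ''n'') (NConst 1)) + 7)) (I (n + 1))"
    unfolding prog_row_def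
  proof (rule runs_For[where I = I])
    show "I 0 (set_nat ''w'' 0 s)" by (simp add: I_def agree_set_nat agree_refl)
    fix m s' assume I: "I m s'"
    then have g: "agree {''w'', ''W''} s s'" by (simp add: I_def)
    show "nval s' (NPlus (nv ''n'') (NConst 1)) = n + 1"
      using s by (simp add: agree_nats[OF g])
    show "runs (QAssign ''W'' [nv ''u'', nv ''w'']
      (QMinus (QVar ''W'' [nv ''u'', nv ''w''])
        (QTimes (QVar ''f'' []) (QVar ''W'' [nv ''v'', nv ''w''])))) s' 12
      (\<lambda>s''. nats s'' ''w'' [] = m \<and> I (Suc m) (set_nat ''w'' (Suc m) s''))"
      if m: "nats s' ''w'' [] = m"
      using I m s uv
      by (intro runs_QAssign)
        (auto simp: I_def agree_set_nat agree_rats_upd agree_nats[OF g] agree_rats[OF g] upd_def)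
  qed
  then show ?thesis by (rule runs_weaken) (auto simp: I_def less_Suc_eq_le)
qed

text \<open>The multiplier is saved in \<open>f\<close> because \<open>prog_row\<close> overwrites
  the entry of \<open>W\<close> at \<open>u\<close>, \<open>v\<close> when it reaches column
  \<open>v\<close>. Row \<open>v\<close> is skipped and so stays intact while the other rows are
  updated in place.\<close>

definition prog_pivot :: com where
  "prog_pivot = For ''u'' (nv ''n'') (Cond (NEq (nv ''u'') (nv ''v'')) Skip
    (Seq (QAssign ''f'' [] (QDivide (QVar ''W'' [nv ''u'', nv ''v'']) (QVar ''W'' [nv ''v'', nv ''v'']))) prog_row))"

lemma runs_prog_pivot:
  assumes s: "nats s ''n'' [] = n" "nats s ''v'' [] = v" and v: "v < n"
  shows "runs prog_pivot s (56 * (n + 1)\<^sup>2) (\<lambda>s'. agree {''u'', ''w'', ''f'', ''W''} s s' \<and>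
    (\<forall>a<n. \<forall>w\<le>n. rats s' ''W'' [a, w] = pivot v (\<lambda>a w. rats s ''W'' [a, w]) a w))"
proof -
  let ?X = "{''u'', ''w'', ''f'', ''W''}"
  let ?P = "pivot v (\<lambda>a w. rats s ''W'' [a, w])"
  define I where "I m s' \<longleftrightarrow> agree ?X s s' \<and>
    (\<forall>a w. w \<le> n \<longrightarrow> rats s' ''W'' [a, w] = (if a < m then ?P a w else rats s ''W'' [a, w]))" for m s'
  have "runs prog_pivot s (ncost (nv ''n'') + 5 + (\<Sum>m<n. (1 + bcost (NEq (nv ''u'') (nv ''v'')) +
      (8 + 30 * (n + 1))) + ncost (nv ''n'') + 7)) (I n)"
    unfolding prog_pivot_def
  proof (rule runs_For[where I = I])
    show "I 0 (set_nat ''u'' 0 s)" by (simp add: I_def agree_set_nat agree_refl)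
    fix m s' assume I: "I m s'"
    then have g: "agree ?X s s'" by (simp add: I_def)
    show "nval s' (nv ''n'') = n" using s by (simp add: agree_nats[OF g])
    assume u: "nats s' ''u'' [] = m"
    let ?Q = "\<lambda>s''. nats s'' ''u'' [] = m \<and> I (Suc m) (set_nat ''u'' (Suc m) s'')"
    have nv: "nats s' ''n'' [] = n" "nats s' ''v'' [] = v" using s by (simp_all add: agree_nats[OF g])
    show "runs (Cond (NEq (nv ''u'') (nv ''v'')) Skip
        (Seq (QAssign ''f'' [] (QDivide (QVar ''W'' [nv ''u'', nv ''v'']) (QVar ''W'' [nv ''v'', nv ''v'']))) prog_row))
      s' (1 + bcost (NEq (nv ''u'') (nv ''v'')) + (8 + 30 * (n + 1))) ?Q"
    proof (rule runs_Cond)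
      assume "bval s' (NEq (nv ''u'') (nv ''v''))"
      then have mv: "m = v" using u nv by simp
      show "runs Skip s' (8 + 30 * (n + 1)) ?Q"
        using I mv u by (intro runs_Skip) (auto simp: I_def agree_set_nat pivot_def less_Suc_eq)
    next
      assume "\<not> bval s' (NEq (nv ''u'') (nv ''v''))"
      then have mv: "m \<noteq> v" using u nv by simp
      define f where "f = rats s' ''W'' [m, v] / rats s' ''W'' [v, v]"
      define s1 where "s1 = s'\<lparr>rats := upd (rats s') ''f'' [] f\<rparr>"
      \<comment> \<open>Row \<open>m\<close> has not been updated yet and row \<open>v\<close> never
        changes, so this is the multiplier of the matrix before the pivot.\<close>
      have f: "f = rats s ''W'' [m, v] / rats s ''W'' [v, v]"
        using I v mv by (auto simp: f_def I_def pivot_def)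
      have s1: "nats s1 = nats s'" "rats s1 ''W'' = rats s' ''W''" "rats s1 ''f'' [] = f"
        by (auto simp: s1_def upd_def)
      have g1: "agree ?X s s1" using g by (simp add: s1_def upd_def agree_rats_upd)
      have "runs prog_row s1 (30 * (n + 1)) ?Q"
      proof (rule runs_weaken[OF runs_prog_row[of s1 n m v]])
        fix s2
        assume a: "agree {''w'', ''W''} s1 s2 \<and> (\<forall>a w. rats s2 ''W'' [a, w] = (if a = m \<and> w \<le> n
          then rats s1 ''W'' [a, w] - rats s1 ''f'' [] * rats s1 ''W'' [v, w] else rats s1 ''W'' [a, w]))"
        have "agree ?X s s2" by (rule agree_trans[OF g1 conjunct1[OF a]]) auto
        moreover have "nats s2 ''u'' [] = m" using agree_nats[OF conjunct1[OF a], of "''u''"] s1 u by simp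
        moreover have "rats s2 ''W'' [a, w] = (if a < Suc m then ?P a w else rats s ''W'' [a, w])"
          if "w \<le> n" for a w
        proof -
          have W: "rats s1 ''W'' [a, w] = (if a < m then ?P a w else rats s ''W'' [a, w])" for a
            using I that by (simp add: I_def s1)
          have "rats s1 ''W'' [v, w] = rats s ''W'' [v, w]" unfolding W by (simp add: pivot_def)
          then show ?thesis using conjunct2[OF a, rule_format, of a w] W[of a] that mv s1 f
            by (auto simp: pivot_def less_Suc_eq)
        qed
        ultimately show "?Q s2" by (simp add: I_def agree_set_nat)
      qed (use s1 u nv mv in auto)
      then show "runs (Seq (QAssign ''f'' [] (QDivide (QVar ''W'' [nv ''u'', nv ''v'']) (QVar ''W'' [nv ''v'', nv ''v'']))) prog_row)
        s' (8 + 30 * (n + 1)) ?Q"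
        using u nv by (intro runs_Seq runs_QAssign) (auto simp: s1_def f_def)
    qed
  qed
  then show ?thesis
    by (rule runs_weaken) (auto simp: I_def power2_eq_square algebra_simps)
qed

definition prog_elim :: com where
  "prog_elim = For ''v'' (nv ''n'')
    (Cond (BAnd (BNot (NEq (nv ''v'') (nv ''i''))) (BNot (NEq (nv ''v'') (nv ''j'')))) prog_pivot Skip)"

lemma others_Suc: "others (Suc m) i j = others m i j @ (if m \<noteq> i \<and> m \<noteq> j then [m] else [])"
  by (simp add: others_def)

lemma runs_prog_elim:
  assumes s: "nats s ''n'' [] = n" "nats s ''i'' [] = i" "nats s ''j'' [] = j"
    and A: "\<forall>a<n. \<forall>w\<le>n. rats s ''W'' [a, w] = A a w"
  shows "runs prog_elim s (80 * (n + 1) ^ 3) (\<lambda>s'. agree {''v'', ''u'', ''w'', ''f'', ''W''} s s' \<and>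
    (\<forall>a<n. \<forall>w\<le>n. rats s' ''W'' [a, w] = reduced n A i j a w))"
proof -
  let ?X = "{''v'', ''u'', ''w'', ''f'', ''W''}"
  let ?g = "BAnd (BNot (NEq (nv ''v'') (nv ''i''))) (BNot (NEq (nv ''v'') (nv ''j'')))"
  \<comment> \<open>\<open>others m i j\<close> is the part of the elimination order reached after
    \<open>m\<close> iterations.\<close>
  define I where "I m s' \<longleftrightarrow> agree ?X s s' \<and>
    (\<forall>a<n. \<forall>w\<le>n. rats s' ''W'' [a, w] = fold pivot (others m i j) A a w)" for m s'
  have "runs prog_elim s (ncost (nv ''n'') + 5
      + (\<Sum>m<n. (1 + bcost ?g + (56 * (n + 1)\<^sup>2)) + ncost (nv ''n'') + 7)) (I n)"
    unfolding prog_elim_def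
  proof (rule runs_For[where I = I])
    show "I 0 (set_nat ''v'' 0 s)" using A by (simp add: I_def agree_set_nat agree_refl others_def)
    fix m s' assume I: "I m s'"
    then have g: "agree ?X s s'" by (simp add: I_def)
    have nij: "nats s' ''n'' [] = n" "nats s' ''i'' [] = i" "nats s' ''j'' [] = j"
      using s by (simp_all add: agree_nats[OF g])
    then show "nval s' (nv ''n'') = n" by simp
    assume v: "nats s' ''v'' [] = m" and m: "m < n"
    let ?Q = "\<lambda>s''. nats s'' ''v'' [] = m \<and> I (Suc m) (set_nat ''v'' (Suc m) s'')"
    show "runs (Cond ?g prog_pivot Skip) s' (1 + bcost ?g + 56 * (n + 1)\<^sup>2) ?Q"
    proof (rule runs_Cond)
      assume "bval s' ?g"
      then have mij: "m \<noteq> i" "m \<noteq> j" using v nij by auto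
      show "runs prog_pivot s' (56 * (n + 1)\<^sup>2) ?Q"
      proof (rule runs_weaken[OF runs_prog_pivot[OF nij(1) v m]])
        fix s2
        assume a: "agree {''u'', ''w'', ''f'', ''W''} s' s2 \<and>
          (\<forall>a<n. \<forall>w\<le>n. rats s2 ''W'' [a, w] = pivot m (\<lambda>a w. rats s' ''W'' [a, w]) a w)"
        have "agree ?X s s2" by (rule agree_trans[OF g conjunct1[OF a]]) auto
        moreover have "nats s2 ''v'' [] = m" using agree_nats[OF conjunct1[OF a], of "''v''"] v by simp
        moreover have "rats s2 ''W'' [a, w] = fold pivot (others (Suc m) i j) A a w" if "a < n" "w \<le> n" for a w
          using a that I m mij by (auto simp: others_Suc pivot_def I_def)
        ultimately show "?Q s2" by (simp add: I_def agree_set_nat)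
      qed simp
    next
      assume "\<not> bval s' ?g"
      then have "m = i \<or> m = j" using v nij by auto
      then show "runs Skip s' (56 * (n + 1)\<^sup>2) ?Q"
        using I v by (intro runs_Skip) (auto simp: I_def agree_set_nat others_Suc)
    qed
  qed
  then show ?thesis
    by (rule runs_weaken)
      (auto simp: I_def reduced_def power2_eq_square power3_eq_cube algebra_simps)
qed

text \<open>Elimination destroys \<open>W\<close>, so every nonzero entry starts from a fresh copy
  of the leading square block of \<open>M\<close> and of \<open>b\<close>.\<close>

definition prog_copy :: com where
  "prog_copy = For ''u'' (nv ''n'') (Seq
    (For ''w'' (nv ''n'') (QAssign ''W'' [nv ''u'', nv ''w''] (QVar ''M'' [nv ''u'', nv ''w''])))
    (QAssign ''W'' [nv ''u'', nv ''n''] (QVar ''b'' [nv ''u''])))"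

definition augmented :: "nat \<Rightarrow> store \<Rightarrow> nat \<Rightarrow> nat \<Rightarrow> rat" where
  "augmented n s u w = (if w < n then rats s ''M'' [u, w] else rats s ''b'' [u])"

lemma runs_prog_copy:
  assumes s: "nats s ''n'' [] = n"
  shows "runs prog_copy s (25 * (n + 1)\<^sup>2) (\<lambda>s'. agree {''u'', ''w'', ''W''} s s' \<and>
    (\<forall>a<n. \<forall>w\<le>n. rats s' ''W'' [a, w] = augmented n s a w))"
proof -
  let ?X = "{''u'', ''w'', ''W''}"
  let ?c = "For ''w'' (nv ''n'') (QAssign ''W'' [nv ''u'', nv ''w''] (QVar ''M'' [nv ''u'', nv ''w'']))"
  define I where "I m s' \<longleftrightarrow> agree ?X s s' \<and>
    (\<forall>a<m. \<forall>w\<le>n. rats s' ''W'' [a, w] = augmented n s a w)" for m s'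
  have "runs prog_copy s (ncost (nv ''n'') + 5
      + (\<Sum>m<n. ((ncost (nv ''n'') + 5 + (\<Sum>m<n. 6 + ncost (nv ''n'') + 7)) + 5) + ncost (nv ''n'') + 7)) (I n)"
    unfolding prog_copy_def
  proof (rule runs_For[where I = I])
    show "I 0 (set_nat ''u'' 0 s)" by (simp add: I_def agree_set_nat agree_refl)
    fix m s' assume I: "I m s'"
    then have g: "agree ?X s s'" by (simp add: I_def)
    have n: "nats s' ''n'' [] = n" using s by (simp add: agree_nats[OF g])
    then show "nval s' (nv ''n'') = n" by simp
    assume u: "nats s' ''u'' [] = m" and m: "m < n"
    let ?Q = "\<lambda>s''. nats s'' ''u'' [] = m \<and> I (Suc m) (set_nat ''u'' (Suc m) s'')"
    define J where "J k s'' \<longleftrightarrow> agree {''w'', ''W''} s' s'' \<and>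
      (\<forall>a w. rats s'' ''W'' [a, w] = (if a = m \<and> w < k then rats s ''M'' [a, w] else rats s' ''W'' [a, w]))" for k s''
    have J_Q: "runs (QAssign ''W'' [nv ''u'', nv ''n''] (QVar ''b'' [nv ''u''])) s'' 5 ?Q" if J: "J n s''" for s''
    proof -
      have g': "agree {''w'', ''W''} s' s''" using J by (simp add: J_def)
      have "agree ?X s s''" by (rule agree_trans[OF g g']) auto
      then show ?thesis
        using J I u n
        by (intro runs_QAssign)
          (auto simp: I_def J_def agree_set_nat agree_rats_upd agree_nats[OF g'] agree_rats[OF g']
            agree_rats[OF g] upd_def augmented_def less_Suc_eq)
    qed
    have "runs ?c s' (ncost (nv ''n'') + 5 + (\<Sum>m<n. 6 + ncost (nv ''n'') + 7))
      (\<lambda>s''. runs (QAssign ''W'' [nv ''u'', nv ''n''] (QVar ''b'' [nv ''u''])) s'' 5 ?Q)"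
    proof (rule runs_For[where I = J])
      show "J 0 (set_nat ''w'' 0 s')" by (simp add: J_def agree_set_nat agree_refl)
      fix k s'' assume J: "J k s''"
      then have g': "agree {''w'', ''W''} s' s''" by (simp add: J_def)
      show "nval s'' (nv ''n'') = n" using n by (simp add: agree_nats[OF g'])
      assume k: "nats s'' ''w'' [] = k"
      show "runs (QAssign ''W'' [nv ''u'', nv ''w''] (QVar ''M'' [nv ''u'', nv ''w''])) s'' 6
        (\<lambda>s2. nats s2 ''w'' [] = k \<and> J (Suc k) (set_nat ''w'' (Suc k) s2))"
        using J k u
        by (intro runs_QAssign)
          (auto simp: J_def agree_set_nat agree_rats_upd agree_nats[OF g'] agree_rats[OF g']
            agree_rats[OF g] upd_def)
    qed (rule J_Q)
    then show "runs (Seq ?c (QAssign ''W'' [nv ''u'', nv ''n''] (QVar ''b'' [nv ''u'']))) s'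
      ((ncost (nv ''n'') + 5 + (\<Sum>m<n. 6 + ncost (nv ''n'') + 7)) + 5) ?Q"
      by (rule runs_Seq)
  qed
  then show ?thesis
    by (rule runs_weaken) (auto simp: I_def power2_eq_square algebra_simps)
qed

section \<open>Emission of one constraint per nonzero entry\<close>

definition row_entry :: "nat \<Rightarrow> (nat \<Rightarrow> nat \<Rightarrow> rat) \<Rightarrow> nat \<times> nat \<Rightarrow> nat \<Rightarrow> rat" where
  "row_entry n A p w = (if w = fst p \<or> w = snd p then reduced n A (fst p) (snd p) (fst p) w else 0)"

text \<open>The list \<open>ps\<close> records which pair each row belongs to. Rows not yet written
  must be 0 because the program stores only the entries in columns \<open>i\<close> and
  \<open>j\<close>.\<close>

definition emitted :: "nat \<Rightarrow> (nat \<Rightarrow> nat \<Rightarrow> rat) \<Rightarrow> (nat \<times> nat) set \<Rightarrow> store \<Rightarrow> bool" where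
  "emitted n A P s \<longleftrightarrow> (\<exists>ps. distinct ps \<and> set ps = P \<and> nats s ''rows'' [] = length ps \<and>
    (\<forall>r<length ps. (\<forall>w. rats s ''Mbar'' [r, w] = row_entry n A (ps ! r) w) \<and>
      rats s ''bbar'' [r] = reduced n A (fst (ps ! r)) (snd (ps ! r)) (fst (ps ! r)) n) \<and>
    (\<forall>r\<ge>length ps. \<forall>w. rats s ''Mbar'' [r, w] = 0))"

lemma emitted_cong:
  assumes "nats s' ''rows'' = nats s ''rows''" "rats s' ''Mbar'' = rats s ''Mbar''"
    "rats s' ''bbar'' = rats s ''bbar''"
  shows "emitted n A P s' = emitted n A P s"
  using assms by (simp add: emitted_def)

lemma emitted_set_nat: "x \<noteq> ''rows'' \<Longrightarrow> emitted n A P (set_nat x v s) = emitted n A P s"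
  by (rule emitted_cong) (simp_all add: nats_set_nat)

text \<open>For \<open>i = j\<close> both assignments to \<open>Mbar\<close> write the same value to
  the same cell. \<open>rows\<close> is incremented last because it indexes the row being
  written.\<close>

definition prog_output :: com where
  "prog_output = Seq (Seq (Seq
    (QAssign ''Mbar'' [nv ''rows'', nv ''j''] (QVar ''W'' [nv ''i'', nv ''j'']))
    (QAssign ''Mbar'' [nv ''rows'', nv ''i''] (QVar ''W'' [nv ''i'', nv ''i''])))
    (QAssign ''bbar'' [nv ''rows''] (QVar ''W'' [nv ''i'', nv ''n''])))
    (NAssign ''rows'' [] (NPlus (nv ''rows'') (NConst 1)))"

lemma emitted_insert:
  assumes e: "emitted n A P s" and ij: "i < n" "j < n" "(i, j) \<notin> P"
    and r: "r = nats s ''rows'' []" "nats s' ''rows'' [] = Suc r"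
    and Mb: "rats s' ''Mbar'' = (rats s ''Mbar'')([r, j] := reduced n A i j i j, [r, i] := reduced n A i j i i)"
    and bb: "rats s' ''bbar'' = (rats s ''bbar'')([r] := reduced n A i j i n)"
  shows "emitted n A (insert (i, j) P) s'"
proof -
  obtain ps where ps: "distinct ps" "set ps = P" "r = length ps"
    and old: "\<And>r' w. r' < length ps \<Longrightarrow> rats s ''Mbar'' [r', w] = row_entry n A (ps ! r') w"
      "\<And>r'. r' < length ps \<Longrightarrow>
        rats s ''bbar'' [r'] = reduced n A (fst (ps ! r')) (snd (ps ! r')) (fst (ps ! r')) n"
    and zero: "\<And>r' w. length ps \<le> r' \<Longrightarrow> rats s ''Mbar'' [r', w] = 0"
    using e r unfolding emitted_def by auto
  have new: "rats s' ''Mbar'' [r, w] = row_entry n A (i, j) w" for w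
    using zero[of r w] ps(3) by (auto simp: Mb row_entry_def)
  have other: "rats s' ''Mbar'' [r', w] = rats s ''Mbar'' [r', w]" "rats s' ''bbar'' [r'] = rats s ''bbar'' [r']"
    if "r' \<noteq> r" for r' w
    using that by (auto simp: Mb bb)
  show ?thesis
    unfolding emitted_def
  proof (intro exI[of _ "ps @ [(i, j)]"] conjI allI impI)
    fix r' assume r': "r' < length (ps @ [(i, j)])"
    show "rats s' ''Mbar'' [r', w] = row_entry n A ((ps @ [(i, j)]) ! r') w" for w
      using r' new other(1) old(1) ps(3) by (cases "r' = r") (simp_all add: nth_append)
    show "rats s' ''bbar'' [r'] = reduced n A (fst ((ps @ [(i, j)]) ! r'))
        (snd ((ps @ [(i, j)]) ! r')) (fst ((ps @ [(i, j)]) ! r')) n"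
      using r' other(2) old(2) ps(3) by (cases "r' = r") (simp_all add: nth_append bb)
  next
    fix r' w assume "length (ps @ [(i, j)]) \<le> r'"
    then show "rats s' ''Mbar'' [r', w] = 0" using other(1) zero ps(3) by simp
  qed (use ps ij r in auto)
qed

lemma agree_upd:
  "agree X s (s\<lparr>rats := q, nats := f\<rparr>) \<longleftrightarrow> (\<forall>y. y \<notin> X \<longrightarrow> f y = nats s y \<and> q y = rats s y)"
  by (simp add: agree_def)

lemma runs_prog_output:
  assumes s: "nats s ''n'' [] = n" "nats s ''i'' [] = i" "nats s ''j'' [] = j"
    and ij: "i < n" "j < n" "(i, j) \<notin> P" and e: "emitted n A P s"
    and W: "\<forall>a<n. \<forall>w\<le>n. rats s ''W'' [a, w] = reduced n A i j a w"
  shows "runs prog_output s 21 (\<lambda>s'. agree {''rows'', ''Mbar'', ''bbar''} s s' \<and> emitted n A (insert (i, j) P) s')"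
proof -
  let ?r = "nats s ''rows'' []"
  let ?Q = "\<lambda>s'. agree {''rows'', ''Mbar'', ''bbar''} s s' \<and> nats s' ''rows'' [] = Suc ?r
    \<and> rats s' ''Mbar'' = (rats s ''Mbar'')([?r, j] := rats s ''W'' [i, j], [?r, i] := rats s ''W'' [i, i])
    \<and> rats s' ''bbar'' = (rats s ''bbar'')([?r] := rats s ''W'' [i, n])"
  have "runs prog_output s (6 + 6 + 5 + 4) ?Q"
    unfolding prog_output_def
    by (intro runs_Seq runs_QAssign runs_NAssign)
      (simp_all add: s upd_def agree_upd)
  then show ?thesis
  proof (rule runs_weaken)
    fix s' assume Q: "?Q s'"
    have "emitted n A (insert (i, j) P) s'"
      using Q W ij by (intro emitted_insert[OF e ij refl]) simp_all
    then show "agree {''rows'', ''Mbar'', ''bbar''} s s' \<and> emitted n A (insert (i, j) P) s'"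
      using Q by blast
  qed simp
qed

text \<open>Zero entries are skipped at constant cost, so the cubic elimination is paid for nonzero
  entries only.\<close>

definition prog_entry :: com where
  "prog_entry = Cond (QEq (QVar ''M'' [nv ''i'', nv ''j'']) (QConst 0)) Skip
    (Seq (Seq prog_copy prog_elim) prog_output)"

lemma augmented_cong: "agree X s s' \<Longrightarrow> ''M'' \<notin> X \<Longrightarrow> ''b'' \<notin> X \<Longrightarrow> augmented n s' = augmented n s"
  by (auto simp: augmented_def agree_def fun_eq_iff)

lemma runs_prog_entry:
  assumes s: "nats s ''n'' [] = n" "nats s ''i'' [] = i" "nats s ''j'' [] = j"
    and ij: "i < n" "j < n" "(i, j) \<notin> P" and e: "emitted n (augmented n s) P s"
  shows "runs prog_entry s (7 + (if augmented n s i j \<noteq> 0 then 130 * (n + 1) ^ 3 else 0))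
    (\<lambda>s'. agree {''v'', ''u'', ''w'', ''f'', ''W'', ''rows'', ''Mbar'', ''bbar''} s s' \<and>
      emitted n (augmented n s) (if augmented n s i j \<noteq> 0 then insert (i, j) P else P) s')"
proof -
  let ?X = "{''v'', ''u'', ''w'', ''f'', ''W'', ''rows'', ''Mbar'', ''bbar''}"
  let ?A = "augmented n s"
  let ?Q = "\<lambda>s'. agree ?X s s' \<and> emitted n ?A (if ?A i j \<noteq> 0 then insert (i, j) P else P) s'"
  let ?g = "QEq (QVar ''M'' [nv ''i'', nv ''j'']) (QConst 0)"
  have g: "bval s ?g \<longleftrightarrow> ?A i j = 0" using s ij by (simp add: augmented_def)
  have "runs prog_entry s (1 + bcost ?g + (1 + (if ?A i j \<noteq> 0 then 130 * (n + 1) ^ 3 else 0))) ?Q"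
    unfolding prog_entry_def
  proof (rule runs_Cond)
    assume "bval s ?g"
    then show "runs Skip s (1 + (if ?A i j \<noteq> 0 then 130 * (n + 1) ^ 3 else 0)) ?Q"
      using e g by (intro runs_Skip) (auto simp: agree_refl)
  next
    assume "\<not> bval s ?g"
    then have nz: "?A i j \<noteq> 0" using g by simp
    have "runs (Seq (Seq prog_copy prog_elim) prog_output) s (25 * (n + 1)\<^sup>2 + 80 * (n + 1) ^ 3 + 21) ?Q"
    proof (intro runs_Seq, rule runs_weaken[OF runs_prog_copy[OF s(1)] order_refl])
      fix s1 assume 1: "agree {''u'', ''w'', ''W''} s s1 \<and> (\<forall>a<n. \<forall>w\<le>n. rats s1 ''W'' [a, w] = ?A a w)"
      note g1 = conjunct1[OF 1]
      have s1: "nats s1 ''n'' [] = n" "nats s1 ''i'' [] = i" "nats s1 ''j'' [] = j"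
        using s by (simp_all add: agree_nats[OF g1])
      show "runs prog_elim s1 (80 * (n + 1) ^ 3) (\<lambda>s'. runs prog_output s' 21 ?Q)"
      proof (rule runs_weaken[OF runs_prog_elim[OF s1 conjunct2[OF 1]] order_refl])
        fix s2 assume 2: "agree {''v'', ''u'', ''w'', ''f'', ''W''} s1 s2 \<and>
          (\<forall>a<n. \<forall>w\<le>n. rats s2 ''W'' [a, w] = reduced n ?A i j a w)"
        have g2: "agree {''v'', ''u'', ''w'', ''f'', ''W''} s s2"
          by (rule agree_trans[OF g1 conjunct1[OF 2]]) auto
        have s2: "nats s2 ''n'' [] = n" "nats s2 ''i'' [] = i" "nats s2 ''j'' [] = j"
          using s by (simp_all add: agree_nats[OF g2])
        have e2: "emitted n ?A P s2"
          using e emitted_cong[of s2 s] by (simp add: agree_nats[OF g2] agree_rats[OF g2])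
        show "runs prog_output s2 21 ?Q"
        proof (rule runs_weaken[OF runs_prog_output[OF s2 ij e2 conjunct2[OF 2]] order_refl])
          fix s3 assume 3: "agree {''rows'', ''Mbar'', ''bbar''} s2 s3 \<and> emitted n ?A (insert (i, j) P) s3"
          have "agree ?X s s3" by (rule agree_trans[OF g2 conjunct1[OF 3]]) auto
          then show "?Q s3" using 3 nz by simp
        qed
      qed
    qed
    moreover have "(n + 1)\<^sup>2 \<le> (n + 1) ^ 3" "1 \<le> (n + 1) ^ 3"
      by (auto intro!: power_increasing one_le_power simp del: One_nat_def)
    then have "25 * (n + 1)\<^sup>2 + 80 * (n + 1) ^ 3 + 21 \<le> 1 + 130 * (n + 1) ^ 3" by linarith
    ultimately show "runs (Seq (Seq prog_copy prog_elim) prog_output) s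
        (1 + (if ?A i j \<noteq> 0 then 130 * (n + 1) ^ 3 else 0)) ?Q"
      unfolding if_P[OF nz] by (elim runs_weaken)
  qed
  then show ?thesis by (rule runs_weaken) auto
qed

text \<open>Row-major order, as in the two loops; \<open>visited n A n 0\<close> is the set of all
  nonzero positions of the leading block.\<close>

definition visited :: "nat \<Rightarrow> (nat \<Rightarrow> nat \<Rightarrow> rat) \<Rightarrow> nat \<Rightarrow> nat \<Rightarrow> (nat \<times> nat) set" where
  "visited n A i j = {(a, c). a < n \<and> c < n \<and> (a < i \<or> a = i \<and> c < j) \<and> A a c \<noteq> 0}"

lemma visited_Suc: "i < n \<Longrightarrow> j < n \<Longrightarrow>
    visited n A i (Suc j) = (if A i j \<noteq> 0 then insert (i, j) (visited n A i j) else visited n A i j)"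
  and visited_row: "visited n A (Suc i) 0 = visited n A i n"
  and visited_0: "visited n A 0 0 = {}"
  by (auto simp: visited_def less_Suc_eq)

definition prog_main :: com where
  "prog_main = Seq (Cond (NLess (nv ''k'') (nv ''t'')) (NAssign ''n'' [] (nv ''k'')) (NAssign ''n'' [] (nv ''t'')))
    (For ''i'' (nv ''n'') (For ''j'' (nv ''n'') prog_entry))"

lemma runs_prog_loops:
  assumes s: "nats s ''n'' [] = n" and A: "A = augmented n s" and e: "emitted n A {} s"
  shows "runs (For ''i'' (nv ''n'') (For ''j'' (nv ''n'') prog_entry)) s
    (6 + (\<Sum>i<n. 14 + (\<Sum>j<n. 15 + (if A i j \<noteq> 0 then 130 * (n + 1) ^ 3 else 0))))
    (emitted n A (visited n A n 0))"
proof -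
  let ?X = "{''v'', ''u'', ''w'', ''f'', ''W'', ''rows'', ''Mbar'', ''bbar''}"
  let ?T = "\<lambda>i j. 7 + (if A i j \<noteq> 0 then 130 * (n + 1) ^ 3 else 0)"
  define I where "I i s' \<longleftrightarrow> agree (?X \<union> {''i'', ''j''}) s s' \<and> emitted n A (visited n A i 0) s'" for i s'
  have "runs (For ''i'' (nv ''n'') (For ''j'' (nv ''n'') prog_entry)) s
    (ncost (nv ''n'') + 5 + (\<Sum>i<n. (ncost (nv ''n'') + 5 + (\<Sum>j<n. ?T i j + ncost (nv ''n'') + 7))
      + ncost (nv ''n'') + 7)) (emitted n A (visited n A n 0))"
  proof (rule runs_For[where I = I])
    show "I 0 (set_nat ''i'' 0 s)"
      using e by (simp add: I_def agree_set_nat agree_refl visited_0 emitted_set_nat nats_set_nat)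
    show "emitted n A (visited n A n 0) s'" if "I n s'" for s' using that by (simp add: I_def)
    fix i s' assume I: "I i s'"
    then have g: "agree (?X \<union> {''i'', ''j''}) s s'" by (simp add: I_def)
    have n: "nats s' ''n'' [] = n" using s by (simp add: agree_nats[OF g])
    then show "nval s' (nv ''n'') = n" by simp
    assume i: "i < n" "nats s' ''i'' [] = i"
    define J where "J j s'' \<longleftrightarrow> agree (?X \<union> {''j''}) s' s'' \<and> emitted n A (visited n A i j) s''" for j s''
    show "runs (For ''j'' (nv ''n'') prog_entry) s'
        (ncost (nv ''n'') + 5 + (\<Sum>j<n. ?T i j + ncost (nv ''n'') + 7))
        (\<lambda>s''. nats s'' ''i'' [] = i \<and> I (Suc i) (set_nat ''i'' (Suc i) s''))"
    proof (rule runs_For[where I = J])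
      show "J 0 (set_nat ''j'' 0 s')"
        using I by (simp add: I_def J_def agree_set_nat agree_refl emitted_set_nat nats_set_nat)
      show "nats s'' ''i'' [] = i \<and> I (Suc i) (set_nat ''i'' (Suc i) s'')" if J: "J n s''" for s''
      proof -
        have g': "agree (?X \<union> {''j''}) s' s''" using J by (simp add: J_def)
        have "agree (?X \<union> {''i'', ''j''}) s s''" by (rule agree_trans[OF g g']) auto
        then show ?thesis
          using J i by (simp add: I_def J_def agree_set_nat emitted_set_nat visited_row agree_nats[OF g'])
      qed
      fix j s'' assume J: "J j s''"
      then have g': "agree (?X \<union> {''j''}) s' s''" by (simp add: J_def)
      have gs: "agree (?X \<union> {''i'', ''j''}) s s''" by (rule agree_trans[OF g g']) auto
      have s'': "nats s'' ''n'' [] = n" "nats s'' ''i'' [] = i"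
        using n i by (simp_all add: agree_nats[OF g'])
      then show "nval s'' (nv ''n'') = n" by simp
      assume j: "j < n" "nats s'' ''j'' [] = j"
      have A'': "augmented n s'' = A" unfolding A by (rule augmented_cong[OF gs]) auto
      have "(i, j) \<notin> visited n A i j" by (simp add: visited_def)
      then have "runs prog_entry s'' (?T i j) (\<lambda>s1. agree ?X s'' s1 \<and> emitted n A (visited n A i (Suc j)) s1)"
        using runs_prog_entry[OF s'' j(2) i(1) j(1), of "visited n A i j"] J
        unfolding A'' visited_Suc[OF i(1) j(1)] J_def by blast
      then show "runs prog_entry s'' (?T i j) (\<lambda>s1. nats s1 ''j'' [] = j \<and> J (Suc j) (set_nat ''j'' (Suc j) s1))"
      proof (rule runs_weaken[OF _ order_refl])
        fix s1 assume 1: "agree ?X s'' s1 \<and> emitted n A (visited n A i (Suc j)) s1"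
        have "agree (?X \<union> {''j''}) s' s1" by (rule agree_trans[OF g' conjunct1[OF 1]]) auto
        then show "nats s1 ''j'' [] = j \<and> J (Suc j) (set_nat ''j'' (Suc j) s1)"
          using 1 j(2) agree_nats[OF conjunct1[OF 1], of "''j''"]
          by (simp add: J_def agree_set_nat emitted_set_nat nats_set_nat)
      qed
    qed
  qed
  then show ?thesis by (rule runs_weaken) (auto simp: algebra_simps intro!: sum_mono)
qed

text \<open>As \<open>n + 1\<close> is at most \<open>2 * t\<close>, the factor 130 becomes 1040.
  Scanning all positions costs at most \<open>50 * t ^ 3\<close>, which is absorbed because
  \<open>l\<close> is at least 1.\<close>

lemma cost_bound:
  fixes n t c l :: nat
  assumes "n \<le> t" "1 \<le> t" "1 \<le> l" "c \<le> l"
  shows "12 + 14 * n + 15 * n * n + c * (130 * (n + 1) ^ 3) \<le> 1100 * (l * t ^ 3)"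
proof -
  have "(n + 1) ^ 3 \<le> (2 * t) ^ 3" using assms by (intro power_mono) auto
  then have "130 * (n + 1) ^ 3 \<le> 1040 * t ^ 3" by (simp add: power_mult_distrib)
  then have "c * (130 * (n + 1) ^ 3) \<le> l * (1040 * t ^ 3)" by (rule mult_le_mono[OF assms(4)])
  moreover have "12 + 14 * n + 15 * n * n \<le> 50 * t ^ 3"
  proof -
    have "t \<le> t ^ 3" "t * t \<le> t ^ 3" "1 \<le> t ^ 3"
      using assms power_increasing[of 1 3 t] power_increasing[of 2 3 t] by (auto simp: power2_eq_square)
    moreover have "n * n \<le> t * t" by (rule mult_le_mono[OF assms(1,1)])
    ultimately show ?thesis using assms(1) by linarith
  qed
  moreover have "t ^ 3 \<le> l * t ^ 3" using assms by simp
  ultimately show ?thesis by linarith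
qed

lemma runs_prog_main:
  assumes n: "n = min (nats s ''k'' []) (nats s ''t'' [])" and A: "A = augmented n s"
    and z: "nats s ''rows'' [] = 0" "\<forall>r w. rats s ''Mbar'' [r, w] = 0"
  shows "runs prog_main s (1100 * (max 1 (card (visited n A n 0)) * max 1 (nats s ''t'' []) ^ 3))
    (emitted n A (visited n A n 0))"
proof -
  let ?s = "s\<lparr>nats := upd (nats s) ''n'' [] n\<rparr>"
  let ?loops = "For ''i'' (nv ''n'') (For ''j'' (nv ''n'') prog_entry)"
  let ?K = "130 * (n + 1) ^ 3"
  let ?T = "6 + (\<Sum>i<n. 14 + (\<Sum>j<n. 15 + (if A i j \<noteq> 0 then ?K else 0)))"
  let ?t = "max 1 (nats s ''t'' [])" and ?l = "max 1 (card (visited n A n 0))"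
  have "augmented n ?s = A" by (simp add: A augmented_def fun_eq_iff)
  moreover have "emitted n A {} ?s" using z by (auto simp: emitted_def upd_def)
  moreover have "nats ?s ''n'' [] = n" by (simp add: upd_def)
  ultimately have "runs ?loops ?s ?T (emitted n A (visited n A n 0))"
    by (intro runs_prog_loops) auto
  moreover have k: "nats s ''k'' [] < nats s ''t'' [] \<Longrightarrow> nats s ''k'' [] = n"
    "\<not> nats s ''k'' [] < nats s ''t'' [] \<Longrightarrow> nats s ''t'' [] = n"
    using n by auto
  ultimately have "runs prog_main s (1 + bcost (NLess (nv ''k'') (nv ''t'')) + 2 + ?T) (emitted n A (visited n A n 0))"
    unfolding prog_main_def
    using k by (intro runs_Seq runs_Cond runs_NAssign) auto
  moreover have "1 + bcost (NLess (nv ''k'') (nv ''t'')) + 2 + ?T \<le> 1100 * (?l * ?t ^ 3)"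
  proof -
    \<comment> \<open>Only visited positions incur the cubic cost, so the double sum is their number
      times the cost of one elimination.\<close>
    have "(\<Sum>i<n. \<Sum>j<n. (if A i j \<noteq> 0 then ?K else 0))
        = (\<Sum>p\<in>{..<n} \<times> {..<n}. if A (fst p) (snd p) \<noteq> 0 then ?K else 0)"
      by (simp add: sum.cartesian_product case_prod_beta)
    also have "\<dots> = (\<Sum>p\<in>visited n A n 0. ?K)"
      by (rule sum.mono_neutral_cong_right) (auto simp: visited_def)
    finally have "?T = 6 + 14 * n + 15 * n * n + card (visited n A n 0) * ?K"
      by (simp add: sum.distrib)
    then have "1 + bcost (NLess (nv ''k'') (nv ''t'')) + 2 + ?T
        = 12 + 14 * n + 15 * n * n + card (visited n A n 0) * ?K" by simp
    also have "\<dots> \<le> 1100 * (?l * ?t ^ 3)"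
      by (rule cost_bound) (auto simp: n)
    finally show ?thesis .
  qed
  ultimately show ?thesis by (rule runs_weaken)
qed

section \<open>The approximation\<close>

lemma mem_polyhedron_nonneg:
  assumes "A \<in> carrier_mat m t" "b \<in> carrier_vec m"
  shows "x \<in> polyhedron_nonneg A b \<longleftrightarrow> x \<in> carrier_vec t \<and> (\<forall>w<t. 0 \<le> x $ w) \<and>
    (\<forall>u<m. (\<Sum>w<t. of_rat (A $$ (u, w)) * x $ w) \<le> of_rat (b $ u))"
proof (cases "x \<in> carrier_vec t")
  case True
  have row: "(map_mat of_rat A *\<^sub>v x) $ u = (\<Sum>w<t. of_rat (A $$ (u, w)) * x $ w)" if "u < m" for u
    using that assms True by (simp add: scalar_prod_def atLeast0LessThan)
  have dims: "dim_vec (map_mat of_rat A *\<^sub>v x) = m" "dim_vec b = m" "dim_col A = t" "dim_vec x = t"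
    using assms True by auto
  have "map_mat of_rat A *\<^sub>v x \<le> map_vec of_rat b
      \<longleftrightarrow> (\<forall>u<m. (\<Sum>w<t. of_rat (A $$ (u, w)) * x $ w) \<le> of_rat (b $ u))"
    unfolding less_eq_vec_def index_map_vec(2) dims using row dims(2) by (simp del: index_mult_mat_vec)
  moreover have "0\<^sub>v t \<le> x \<longleftrightarrow> (\<forall>w<t. 0 \<le> x $ w)"
    using dims(4) by (simp add: less_eq_vec_def)
  ultimately show ?thesis unfolding polyhedron_nonneg_def dims using True by blast
next
  case False
  then show ?thesis using assms by (simp add: polyhedron_nonneg_def)
qed

text \<open>Every entry is at least \<open>m\<close>, so \<open>k * m\<close> is at most
  \<open>S\<close> and \<open>k * S\<close> at most \<open>(S / m) ^ 2 * m\<close>. This turns the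
  loss in the elimination argument into the factor \<open>B ^ 2\<close> on each right-hand
  side.\<close>

lemma B_ratio_bound:
  assumes b: "b \<in> carrier_vec k" "\<forall>i<k. 0 < b $ i" and u: "u < k"
  shows "0 < B_ratio b" "of_nat k * (\<Sum>i<k. b $ i) \<le> (B_ratio b)\<^sup>2 * b $ u"
proof -
  define S m where "S = (\<Sum>i<k. b $ i)" and "m = Min {b $ i |i. i < k}"
  have B: "B_ratio b = S / m" using b by (simp add: B_ratio_def S_def m_def)
  have set_eq: "{b $ i |i. i < k} = (\<lambda>i. b $ i) ` {..<k}" by auto
  have fin: "finite {b $ i |i. i < k}" and ne: "{b $ i |i. i < k} \<noteq> {}"
    unfolding set_eq using u by auto
  have m: "0 < m" using Min_in[OF fin ne] b by (auto simp: m_def)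
  have mle: "m \<le> b $ i" if "i < k" for i unfolding m_def using that by (intro Min_le[OF fin]) auto
  have kS: "of_nat k * m \<le> S"
    using sum_mono[of "{..<k}" "\<lambda>_. m" "\<lambda>i. b $ i"] mle by (simp add: S_def)
  moreover have "0 < of_nat k * m" using u m by simp
  ultimately have S: "0 < S" by linarith
  then show "0 < B_ratio b" using m by (simp add: B)
  have "of_nat k * S = of_nat k * m * S / m" using m by simp
  also have "\<dots> \<le> S * S / m" using kS S m by (intro divide_right_mono mult_right_mono) auto
  also have "\<dots> = (S / m)\<^sup>2 * m" using m by (simp add: power2_eq_square)
  also have "\<dots> \<le> (S / m)\<^sup>2 * b $ u" using mle[OF u] by (intro mult_left_mono) auto
  finally show "of_nat k * (\<Sum>i<k. b $ i) \<le> (B_ratio b)\<^sup>2 * b $ u" by (simp add: B S_def)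
qed

text \<open>Rows beyond \<open>n = min k t\<close> have no diagonal entry and are redundant for \<open>x \<ge> 0\<close>; columns beyond
  \<open>n\<close> vanish.\<close>

locale Z_plus_instance =
  fixes k t n :: nat and M :: "rat mat" and b :: "rat vec" and A :: "nat \<Rightarrow> nat \<Rightarrow> rat"
  assumes M: "M \<in> Z_plus k t" and b: "b \<in> carrier_vec k" "\<forall>i<k. 0 < b $ i"
    and n: "n = min k t"
    and A: "\<And>u w. u < n \<Longrightarrow> w < n \<Longrightarrow> A u w = M $$ (u, w)"
    and An: "\<And>u. u < n \<Longrightarrow> A u n = b $ u"
begin

abbreviation "R \<equiv> \<lambda>u w. of_rat (A u w) :: real"

lemma carrier: "M \<in> carrier_mat k t"
  and offdiag: "u < k \<Longrightarrow> w < t \<Longrightarrow> u \<noteq> w \<Longrightarrow> M $$ (u, w) \<le> 0"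
  and colsum: "w < t \<Longrightarrow> 0 \<le> (\<Sum>u<k. M $$ (u, w))"
  using M by (auto simp: Z_plus_def)

text \<open>For a column \<open>w < n\<close>, the rows from \<open>n\<close> on lie below the
  diagonal and have nonpositive entries; dropping them can only increase the column sum.\<close>

lemma sum_rows_le:
  assumes "\<And>u. n \<le> u \<Longrightarrow> u < k \<Longrightarrow> f u \<le> 0"
  shows "(\<Sum>u<k. f u) \<le> (\<Sum>u<n. f u :: 'a::linordered_field)"
proof -
  have "(\<Sum>u<k. f u) = (\<Sum>u<n. f u) + (\<Sum>u\<in>{..<k}-{..<n}. f u)"
    using n sum.subset_diff[of "{..<n}" "{..<k}" f] by (auto simp: add.commute)
  moreover have "(\<Sum>u\<in>{..<k}-{..<n}. f u) \<le> 0" using assms by (intro sum_nonpos) auto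
  ultimately show ?thesis by linarith
qed

lemma Z_plus_on_A: "Z_plus_on {..<n} A"
  unfolding Z_plus_on_def
proof (intro conjI ballI impI)
  show "A u w \<le> 0" if "u \<in> {..<n}" "w \<in> {..<n}" "u \<noteq> w" for u w
    using that offdiag n by (simp add: A)
  fix w assume w: "w \<in> {..<n}"
  have "0 \<le> (\<Sum>u<k. M $$ (u, w))" using w n by (intro colsum) auto
  also have "\<dots> \<le> (\<Sum>u<n. M $$ (u, w))" using w n by (intro sum_rows_le offdiag) auto
  also have "\<dots> = (\<Sum>u<n. A u w)" using w by (intro sum.cong) (auto simp: A)
  finally show "0 \<le> (\<Sum>u<n. A u w)" .
qed simp

lemma A_rhs: "\<forall>u<n. 0 \<le> A u n"
proof (intro allI impI)
  fix u assume u: "u < n"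
  then have "u < k" using n by simp
  then show "0 \<le> A u n" using b An[OF u] by (simp add: less_imp_le)
qed

lemma Z_plus_on_R: "Z_plus_on {..<n} R"
  using Z_plus_on_A by (simp add: Z_plus_on_def flip: of_rat_sum)

lemma R_rhs: "\<forall>u<n. 0 \<le> R u n"
  using A_rhs by simp

lemma reduced_R: "reduced n R i j u w = of_rat (reduced n A i j u w)"
  unfolding reduced_def by (rule fold_pivot_hom) (auto simp: of_rat_diff of_rat_mult of_rat_divide)

text \<open>A column beyond \<open>n\<close> exists only if \<open>n = k\<close>. It meets no
  diagonal position, so its entries are nonpositive with a nonnegative sum.\<close>

lemma column_0:
  assumes "u < n" "n \<le> w" "w < t"
  shows "M $$ (u, w) = 0"
proof -
  have k: "n = k" using assms n by auto
  have "(\<Sum>u<k. - M $$ (u, w)) = 0"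
  proof (rule antisym)
    show "(\<Sum>u<k. - M $$ (u, w)) \<le> 0" using colsum assms by (simp add: sum_negf)
    show "0 \<le> (\<Sum>u<k. - M $$ (u, w))" using offdiag assms k by (intro sum_nonneg) auto
  qed
  then have "\<forall>u\<in>{..<k}. - M $$ (u, w) = 0"
    using offdiag assms k by (subst (asm) sum_nonneg_eq_0_iff) auto
  then show ?thesis using assms k by auto
qed

lemma row_sum:
  assumes "u < n"
  shows "(\<Sum>w<t. of_rat (M $$ (u, w)) * x w) = (\<Sum>w<n. R u w * (x w :: real))"
  using n assms column_0 A by (intro sum.mono_neutral_cong_right) auto

lemma row_entry_sum:
  assumes "i < n" "j < n"
  shows "(\<Sum>w<t. of_rat (row_entry n A (i, j) w) * x w) = (\<Sum>w\<in>{i, j}. reduced n R i j i w * (x w :: real))"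
proof -
  have "i < t" "j < t" using n assms by auto
  then show ?thesis by (intro sum.mono_neutral_cong_right) (auto simp: row_entry_def reduced_R)
qed

lemma enc_A: "(\<Sum>u<n. \<Sum>w\<le>n. enc_rat (A u w)) \<le> enc_mat M + enc_vec b"
proof -
  have "(\<Sum>u<n. \<Sum>w\<le>n. enc_rat (A u w))
      = (\<Sum>u<n. (\<Sum>w<n. enc_rat (M $$ (u, w))) + enc_rat (b $ u))"
    by (intro sum.cong) (auto simp: A An simp flip: lessThan_Suc_atMost)
  also have "\<dots> \<le> (\<Sum>u<n. (\<Sum>w<t. enc_rat (M $$ (u, w))) + enc_rat (b $ u))"
    using n by (intro sum_mono add_mono sum_mono2) auto
  also have "\<dots> \<le> (\<Sum>u<k. (\<Sum>w<t. enc_rat (M $$ (u, w))) + enc_rat (b $ u))"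
    using n by (intro sum_mono2) auto
  also have "\<dots> \<le> enc_mat M + enc_vec b"
    using carrier b by (simp add: enc_mat_def enc_vec_def sum.distrib)
  finally show ?thesis .
qed

section \<open>The output system, for a list of all nonzero positions of the leading block\<close>

context
  fixes ps :: "(nat \<times> nat) list" and Mbar :: "rat mat" and bbar :: "rat vec"
  assumes ps: "set ps = visited n A n 0"
  defines "Mbar \<equiv> mat (length ps) t (\<lambda>(r, w). row_entry n A (ps ! r) w)"
    and "bbar \<equiv> vec (length ps) (\<lambda>r. reduced n A (fst (ps ! r)) (snd (ps ! r)) (fst (ps ! r)) n)"
begin

lemma ps_nth:
  assumes "r < length ps"
  obtains i j where "ps ! r = (i, j)" "i < n" "j < n" "i < t" "j < t"
proof -
  have "ps ! r \<in> visited n A n 0" using ps assms nth_mem by blast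
  then show ?thesis using that n by (auto simp: visited_def)
qed

text \<open>In the row for \<open>(i, j)\<close>, the entry at \<open>i\<close> is a diagonal entry
  of a reduced matrix and hence nonnegative; for distinct \<open>i\<close> and \<open>j\<close> the
  entry at \<open>j\<close> is off-diagonal and hence nonpositive.\<close>

lemma M_two_Mbar: "Mbar \<in> M_two (length ps) t"
proof -
  have "card {w. w < t \<and> 0 < Mbar $$ (r, w)} \<le> 1 \<and> card {w. w < t \<and> Mbar $$ (r, w) < 0} \<le> 1"
    if r: "r < length ps" for r
  proof -
    obtain i j where ij: "ps ! r = (i, j)" "i < n" "j < n" using ps_nth[OF r] .
    have "0 < reduced n A i j i j \<Longrightarrow> i = j"
      using reduced_offdiag_nonpos[OF Z_plus_on_A ij(2,3)] by (meson not_less)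
    then have "{w. w < t \<and> 0 < Mbar $$ (r, w)} \<subseteq> {i}"
      using r ij
      by (auto simp: Mbar_def row_entry_def not_less[symmetric] split: if_splits)
    moreover have "{w. w < t \<and> Mbar $$ (r, w) < 0} \<subseteq> {j}"
      using r ij reduced_diag_nonneg[OF Z_plus_on_A ij(2,3)]
      by (auto simp: Mbar_def row_entry_def not_le[symmetric] split: if_splits)
    ultimately show ?thesis
      using card_mono[of "{i}"] card_mono[of "{j}"] by simp
  qed
  then show ?thesis by (simp add: M_two_def Mbar_def)
qed

lemma Mbar_carrier: "Mbar \<in> carrier_mat (length ps) t" "bbar \<in> carrier_vec (length ps)"
  by (simp_all add: Mbar_def bbar_def)

lemma mem_output: "x \<in> polyhedron_nonneg Mbar bbar \<longleftrightarrow> x \<in> carrier_vec t \<and> (\<forall>w<t. 0 \<le> x $ w) \<and>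
  (\<forall>(i, j)\<in>visited n A n 0. (\<Sum>w\<in>{i, j}. reduced n R i j i w * x $ w) \<le> reduced n R i j i n)"
proof -
  have "(\<Sum>w<t. of_rat (Mbar $$ (r, w)) * x $ w) = (\<Sum>w<t. of_rat (row_entry n A (ps ! r) w) * x $ w)"
    if "r < length ps" for r
    using that by (intro sum.cong) (auto simp: Mbar_def)
  then have "(\<forall>r<length ps. (\<Sum>w<t. of_rat (Mbar $$ (r, w)) * x $ w) \<le> of_rat (bbar $ r)) \<longleftrightarrow>
    (\<forall>p\<in>set ps. (\<Sum>w<t. of_rat (row_entry n A p w) * x $ w) \<le> of_rat (reduced n A (fst p) (snd p) (fst p) n))"
    by (simp add: all_set_conv_all_nth bbar_def)
  also have "\<dots> \<longleftrightarrow> (\<forall>(i, j)\<in>visited n A n 0.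
      (\<Sum>w\<in>{i, j}. reduced n R i j i w * x $ w) \<le> reduced n R i j i n)"
    unfolding ps by (intro ball_cong) (auto simp: visited_def row_entry_sum reduced_R)
  finally show ?thesis unfolding mem_polyhedron_nonneg[OF Mbar_carrier] by simp
qed

lemma polyhedron_subset_output: "polyhedron_nonneg M b \<subseteq> polyhedron_nonneg Mbar bbar"
proof
  fix x assume "x \<in> polyhedron_nonneg M b"
  then have x: "x \<in> carrier_vec t" "\<forall>w<t. 0 \<le> x $ w"
    and Mx: "\<forall>u<k. (\<Sum>w<t. of_rat (M $$ (u, w)) * x $ w) \<le> of_rat (b $ u)"
    by (auto simp: mem_polyhedron_nonneg[OF carrier b(1)])
  have "\<forall>u<n. (\<Sum>w<n. R u w * x $ w) \<le> R u n"
  proof (intro allI impI)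
    fix u assume u: "u < n"
    then have "u < k" using n by simp
    then show "(\<Sum>w<n. R u w * x $ w) \<le> R u n"
      using Mx[rule_format, of u] row_sum[OF u, of "\<lambda>w. x $ w"] by (simp add: An[OF u])
  qed
  then have "(\<Sum>w\<in>{i, j}. reduced n R i j i w * x $ w) \<le> reduced n R i j i n"
    if "(i, j) \<in> visited n A n 0" for i j
    using that by (intro reduced_valid[OF Z_plus_on_R]) (auto simp: visited_def)
  then show "x \<in> polyhedron_nonneg Mbar bbar" using x by (auto simp: mem_output)
qed

lemma output_subset_scaled:
  assumes k: "1 \<le> k"
  shows "polyhedron_nonneg Mbar bbar \<subseteq> scale_set (of_rat ((B_ratio b)\<^sup>2)) (polyhedron_nonneg M b)"
proof
  fix x assume "x \<in> polyhedron_nonneg Mbar bbar"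
  then have x: "x \<in> carrier_vec t" "\<forall>w<t. 0 \<le> x $ w"
    and red: "\<forall>(i, j)\<in>visited n A n 0. (\<Sum>w\<in>{i, j}. reduced n R i j i w * x $ w) \<le> reduced n R i j i n"
    by (auto simp: mem_output)
  define \<alpha> :: real where "\<alpha> = of_rat ((B_ratio b)\<^sup>2)"
  have \<alpha>: "0 < \<alpha>" using B_ratio_bound(1)[OF b, of 0] k by (simp add: \<alpha>_def)
  have row: "(\<Sum>w<t. of_rat (M $$ (u, w)) * x $ w) \<le> \<alpha> * of_rat (b $ u)" if u: "u < k" for u
  proof (cases "u < n")
    case True
    have "(\<Sum>w<t. of_rat (M $$ (u, w)) * x $ w) \<le> of_nat n * (\<Sum>v<n. R v n)"
      unfolding row_sum[OF True]
      using x n red True by (intro reduced_sound[OF Z_plus_on_R R_rhs]) (auto simp: visited_def)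
    also have "\<dots> = of_rat (of_nat n * (\<Sum>v<n. b $ v))"
      by (simp add: of_rat_mult of_rat_sum An)
    also have "of_nat n * (\<Sum>v<n. b $ v) \<le> of_nat k * (\<Sum>v<k. b $ v)"
      using n b by (intro mult_mono sum_mono2 sum_nonneg) (auto simp: less_imp_le)
    also have "\<dots> \<le> (B_ratio b)\<^sup>2 * b $ u" by (rule B_ratio_bound(2)[OF b u])
    finally show ?thesis by (simp add: of_rat_less_eq \<alpha>_def of_rat_mult)
  next
    case False
    \<comment> \<open>As \<open>u\<close> is less than \<open>k\<close> but not less than
      \<open>n\<close>, here \<open>n = t\<close> and row \<open>u\<close> has no diagonal
      entry.\<close>
    have "(\<Sum>w<t. of_rat (M $$ (u, w)) * x $ w) \<le> 0"
      using False n u x offdiag by (intro sum_nonpos mult_nonpos_nonneg) auto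
    also have "0 \<le> \<alpha> * of_rat (b $ u)" using \<alpha> b u by (auto simp: less_imp_le)
    finally show ?thesis .
  qed
  define y where "y = (1 / \<alpha>) \<cdot>\<^sub>v x"
  have "(\<Sum>w<t. of_rat (M $$ (u, w)) * y $ w) \<le> of_rat (b $ u)" if u: "u < k" for u
  proof -
    have "(\<Sum>w<t. of_rat (M $$ (u, w)) * y $ w) = (\<Sum>w<t. of_rat (M $$ (u, w)) * x $ w) / \<alpha>"
      unfolding sum_divide_distrib using x by (intro sum.cong) (auto simp: y_def)
    then show ?thesis using row[OF u] \<alpha> by (simp add: pos_divide_le_eq mult.commute)
  qed
  then have "y \<in> polyhedron_nonneg M b"
    using x \<alpha> by (auto simp: mem_polyhedron_nonneg[OF carrier b(1)] y_def)
  moreover have "x = \<alpha> \<cdot>\<^sub>v y" using x \<alpha> by (auto simp: y_def)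
  ultimately show "x \<in> scale_set (of_rat ((B_ratio b)\<^sup>2)) (polyhedron_nonneg M b)"
    unfolding scale_set_def \<alpha>_def[symmetric] by blast
qed

lemma enc_output:
  assumes r: "r < length ps"
  defines "E \<equiv> enc_mat M + enc_vec b"
  shows "w < t \<Longrightarrow> enc_rat (Mbar $$ (r, w)) \<le> 6 * E\<^sup>2 + 4 * E + 3"
    and "enc_rat (bbar $ r) \<le> 6 * E\<^sup>2 + 4 * E + 3"
proof -
  obtain i j where ij: "ps ! r = (i, j)" "i < n" "j < n" using ps_nth[OF r] .
  note enc = enc_reduced[OF Z_plus_on_A A_rhs ij(2,3) enc_A, folded E_def]
  \<comment> \<open>Entries outside columns \<open>i\<close> and \<open>j\<close> are 0, which still
    has positive size.\<close>
  have "enc_rat 0 \<le> 3" using enc_rat_le[of 1 0 0 0] by simp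
  then show "enc_rat (Mbar $$ (r, w)) \<le> 6 * E\<^sup>2 + 4 * E + 3" if "w < t"
    using that r ij enc[of w] by (auto simp: Mbar_def row_entry_def intro: trans_le_add2)
  show "enc_rat (bbar $ r) \<le> 6 * E\<^sup>2 + 4 * E + 3"
    using r ij enc[of n] by (simp add: bbar_def)
qed

end

lemma card_visited_le: "card (visited n A n 0) \<le> nnz M"
  unfolding nnz_def
proof (rule card_mono)
  have "{(i, j). i < dim_row M \<and> j < dim_col M \<and> M $$ (i, j) \<noteq> 0} \<subseteq> {..<dim_row M} \<times> {..<dim_col M}"
    by auto
  then show "finite {(i, j). i < dim_row M \<and> j < dim_col M \<and> M $$ (i, j) \<noteq> 0}"
    by (rule finite_subset) simp
  show "visited n A n 0 \<subseteq> {(i, j). i < dim_row M \<and> j < dim_col M \<and> M $$ (i, j) \<noteq> 0}"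
    using carrier n by (auto simp: visited_def A)
qed

end

theorem theorem6p4:
  shows "\<exists>(prog :: com) (C :: nat) (p :: nat poly).
    \<forall>(k :: nat) (t :: nat) (l :: nat) (M :: rat mat) (b :: rat vec).
      1 \<le> k \<longrightarrow> M \<in> Z_plus k t \<longrightarrow> nnz M = l \<longrightarrow>
      b \<in> carrier_vec k \<longrightarrow> (\<forall>i<k. 0 < b $ i) \<longrightarrow>
      (\<exists>steps s l' Mbar bbar.
        exec prog (input_store M b) steps s \<and>
        steps \<le> C * (max 1 l * max 1 t ^ 3) \<and>
        l' = output_rows s \<and> Mbar = output_mat t s \<and> bbar = output_vec s \<and>
        l' \<le> l \<and> Mbar \<in> M_two l' t \<and> bbar \<in> carrier_vec l' \<and>
        polyhedron_nonneg M b \<subseteq> polyhedron_nonneg Mbar bbar \<and>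
        polyhedron_nonneg Mbar bbar
          \<subseteq> scale_set (real_of_rat ((B_ratio b)\<^sup>2)) (polyhedron_nonneg M b) \<and>
        (\<forall>i<l'. \<forall>j<t. enc_rat (Mbar $$ (i, j)) \<le> poly p (enc_mat M + enc_vec b)) \<and>
        (\<forall>i<l'. enc_rat (bbar $ i) \<le> poly p (enc_mat M + enc_vec b)))"
proof (rule exI[of _ prog_main], rule exI[of _ 1100], rule exI[of _ "[:3, 4, 6:]"], intro allI impI)
  fix k t l :: nat and M :: "rat mat" and b :: "rat vec"
  assume k: "1 \<le> k" and M: "M \<in> Z_plus k t" and l: "nnz M = l"
    and b: "b \<in> carrier_vec k" "\<forall>i<k. 0 < b $ i"
  define n A where "n = min k t" and "A = augmented n (input_store M b)"
  have dims: "dim_row M = k" "dim_col M = t" "dim_vec b = k" using M b by (auto simp: Z_plus_def)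
  interpret Z_plus_instance k t n M b A
    by unfold_locales (use M b in \<open>auto simp: n_def A_def augmented_def input_store_def dims\<close>)
  have "runs prog_main (input_store M b)
      (1100 * (max 1 (card (visited n A n 0)) * max 1 (nats (input_store M b) ''t'' []) ^ 3))
      (emitted n A (visited n A n 0))"
    by (rule runs_prog_main) (auto simp: A_def n_def input_store_def dims)
  then obtain steps s where ex: "exec prog_main (input_store M b) steps s"
    and steps: "steps \<le> 1100 * (max 1 (card (visited n A n 0)) * max 1 t ^ 3)"
    and em: "emitted n A (visited n A n 0) s"
    unfolding runs_def by (auto simp: input_store_def dims)
  obtain ps where ps: "distinct ps" "set ps = visited n A n 0" "nats s ''rows'' [] = length ps"
    and out: "\<forall>r<length ps. (\<forall>w. rats s ''Mbar'' [r, w] = row_entry n A (ps ! r) w) \<and>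
      rats s ''bbar'' [r] = reduced n A (fst (ps ! r)) (snd (ps ! r)) (fst (ps ! r)) n"
    using em unfolding emitted_def by blast
  have rows: "output_rows s = length ps" using ps by (simp add: output_rows_def)
  have mat: "output_mat t s = mat (length ps) t (\<lambda>(r, w). row_entry n A (ps ! r) w)"
    using out by (auto simp: output_mat_def rows intro!: eq_matI)
  have vec: "output_vec s = vec (length ps) (\<lambda>r. reduced n A (fst (ps ! r)) (snd (ps ! r)) (fst (ps ! r)) n)"
    using out by (auto simp: output_vec_def rows intro!: eq_vecI)
  have card: "card (visited n A n 0) \<le> l" using card_visited_le l by simp
  have len: "length ps \<le> l" using card ps distinct_card[of ps] by simp
  \<comment> \<open>The program pays for nonzero entries of the leading block, while
    \<open>l\<close> counts those of all of \<open>M\<close>.\<close>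
  have "1100 * (max 1 (card (visited n A n 0)) * max 1 t ^ 3) \<le> 1100 * (max 1 l * max 1 t ^ 3)"
    using card by (intro mult_le_mono) auto
  with steps have steps: "steps \<le> 1100 * (max 1 l * max 1 t ^ 3)" by (rule order_trans)
  \<comment> \<open>The coefficients, in ascending order, are those of the size bound in
    \<open>enc_output\<close>.\<close>
  have poly: "poly [:3, 4, 6:] E = 6 * E\<^sup>2 + 4 * E + 3" for E :: nat
    by (simp add: power2_eq_square algebra_simps)
  show "\<exists>steps s l' Mbar bbar.
        exec prog_main (input_store M b) steps s \<and>
        steps \<le> 1100 * (max 1 l * max 1 t ^ 3) \<and>
        l' = output_rows s \<and> Mbar = output_mat t s \<and> bbar = output_vec s \<and>
        l' \<le> l \<and> Mbar \<in> M_two l' t \<and> bbar \<in> carrier_vec l' \<and>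
        polyhedron_nonneg M b \<subseteq> polyhedron_nonneg Mbar bbar \<and>
        polyhedron_nonneg Mbar bbar
          \<subseteq> scale_set (real_of_rat ((B_ratio b)\<^sup>2)) (polyhedron_nonneg M b) \<and>
        (\<forall>i<l'. \<forall>j<t. enc_rat (Mbar $$ (i, j)) \<le> poly [:3, 4, 6:] (enc_mat M + enc_vec b)) \<and>
        (\<forall>i<l'. enc_rat (bbar $ i) \<le> poly [:3, 4, 6:] (enc_mat M + enc_vec b))"
    using ex steps len k M_two_Mbar[OF ps(2)] Mbar_carrier(2)[of ps] polyhedron_subset_output[OF ps(2)]
      output_subset_scaled[OF ps(2) k] enc_output[OF ps(2)]
    unfolding poly by (intro exI conjI) (auto simp: rows mat vec)
qed

end
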